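(* Let $\mathbf{A}$ be a commutative ring and $A\in\mathbf{A}^{m\times n}$ a matrix; let $t$ be an indeterminate and $A^\circ=Q_n^{-1}\,{}^{\mathrm t}\!A\,Q_m$. The following are equivalent: 1. $A$ is locally simple over $\mathbf{A}$. 2. $A$ is locally simple over $\mathbf{A}(t)$. 3. $A$ is quasi-simple over $\mathbf{A}(t)$. 4. $A$ and $A^\circ$ are crossed over $\mathbf{A}(t)$.
   Context: $Q_r$ denotes the $r\times r$ diagonal matrix with entries $1,t,t^2,\dots,t^{r-1}$; so if $A=(a_{i,j})$, then $A^\circ=(t^{j-i}a_{j,i})$, an $n\times m$ matrix over $\mathbf{A}[t,1/t]$. $\mathbf{A}(t)=S^{-1}\mathbf{A}[t]$ where $S$ is the set of primitive polynomials (those whose coefficients generate the ideal $\langle1\rangle$). Matrices are identified with linear maps between free modules. A matrix is locally simple if the image of the corresponding linear map is a direct summand of the target (equivalently there is a matrix $B$ with $ABA=A$). A linear map $\varphi:E\to F$ between free modules of finite dimensions $n$ and $m$ is quasi-simple if for suitable bases $(e_1,\dots,e_n)$ of $E$ and $(f_1,\dots,f_m)$ of $F$ one has $\varphi(e_i)=r_if_i$ for $1\le i\le\min(m,n)$, where the $r_i$ are idempotents with $r_ir_{i+1}=r_{i+1}$ for $1\le i<\min(m,n)$, and $\varphi(e_i)=0$ for $i>\min(m,n)$. Two linear maps $\varphi:E\to F$, $\varphi^\bullet:F\to E$ are crossed if $\operatorname{Im}\varphi\oplus\operatorname{Ker}\varphi^\bullet=F$ and $\operatorname{Ker}\varphi\oplus\operatorname{Im}\varphi^\bullet=E$.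 *)

theory Defs
  imports
    "HOL-Computational_Algebra.Polynomial"
    "HOL-Algebra.Ideal"
    "Jordan_Normal_Form.Matrix"
    "Jordan_Normal_Form.Matrix_Kernel"
begin

(* Otherwise lift_definition below would also unfold 'a poly to coefficient functions. *)
lifting_forget poly.lifting

section \<open>Primitive polynomials\<close>

definition primitive_poly :: "'a::comm_ring_1 poly \<Rightarrow> bool" where
  "primitive_poly p \<longleftrightarrow> Idl\<^bsub>class_ring\<^esub> (range (coeff p)) = UNIV"

lemma ideal_class_ring_iff:
  fixes I :: "'a::comm_ring_1 set"
  shows "ideal I class_ring \<longleftrightarrow>
    0 \<in> I \<and> (\<forall>a\<in>I. \<forall>b\<in>I. a + b \<in> I) \<and> (\<forall>a\<in>I. \<forall>x. x * a \<in> I)"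
    (is "_ \<longleftrightarrow> ?R")
proof
  assume "ideal I class_ring"
  then interpret ideal I "class_ring :: 'a ring" .
  show ?R
    using zero_closed a_closed I_l_closed by auto
next
  assume R: ?R
  have neg: "- a \<in> I" if "a \<in> I" for a
  proof -
    have "(-1) * a \<in> I" using R that by blast
    thus ?thesis by simp
  qed
  have grp: "group (add_monoid (class_ring :: 'a ring))"
    by (rule abelian_group.a_group[OF ring.is_abelian_group[OF class_ring.ring_axioms]])
  have "additive_subgroup I (class_ring :: 'a ring)"
    unfolding additive_subgroup_def
  proof (rule group.subgroupI[OF grp])
    fix a assume "a \<in> I"
    moreover have "m_inv (add_monoid class_ring) a = - a"
      by (rule group.inv_equality[OF grp]) simp_all
    ultimately show "m_inv (add_monoid class_ring) a \<in> I"
      using neg by metis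
  next
    fix a b assume "a \<in> I" "b \<in> I"
    thus "mult (add_monoid class_ring) a b \<in> I" using R by simp
  next
    show "I \<noteq> {}" using R by blast
  qed auto
  thus "ideal I class_ring"
  proof (rule ideal.intro[OF _ class_ring.ring_axioms])
    show "ideal_axioms I (class_ring :: 'a ring)"
    proof
      fix a x :: 'a assume "a \<in> I"
      hence *: "x * a \<in> I" using R by blast
      show "mult class_ring x a \<in> I" using * by simp
      show "mult class_ring a x \<in> I" using * by (simp add: mult.commute[of a x])
    qed
  qed
qed

lemma ideal_sum_mem:
  fixes I :: "'a::comm_ring_1 set"
  assumes "ideal I class_ring" "\<And>i. i \<in> S \<Longrightarrow> f i \<in> I"
  shows "sum f S \<in> I"
proof -
  have zero: "0 \<in> I"
    using assms(1) unfolding ideal_class_ring_iff by blast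
  have add: "a + b \<in> I" if "a \<in> I" "b \<in> I" for a b
    using assms(1) that unfolding ideal_class_ring_iff by blast
  show ?thesis
    using assms(2) by (induction S rule: infinite_finite_induct) (auto intro: zero add)
qed

lemma ideal_diff_mem:
  fixes I :: "'a::comm_ring_1 set"
  assumes "ideal I class_ring" "a \<in> I" "b \<in> I"
  shows "a - b \<in> I"
proof -
  have "(-1) * b \<in> I" using assms unfolding ideal_class_ring_iff by blast
  hence "a + (-1) * b \<in> I" using assms unfolding ideal_class_ring_iff by blast
  thus ?thesis by simp
qed

lemma primitive_polyD:
  assumes "primitive_poly p" "ideal I class_ring" "range (coeff p) \<subseteq> I"
  shows "I = UNIV"
  using assms unfolding primitive_poly_def genideal_def by blast

lemma primitive_polyI:
  fixes p :: "'a::comm_ring_1 poly"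
  assumes "\<And>I. ideal I (class_ring :: 'a ring) \<Longrightarrow> range (coeff p) \<subseteq> I \<Longrightarrow> 1 \<in> I"
  shows "primitive_poly p"
proof -
  have "x \<in> I" if I: "ideal I (class_ring :: 'a ring)" "range (coeff p) \<subseteq> I" for I and x :: 'a
  proof -
    have "x * 1 \<in> I"
      using assms[OF I] I(1) unfolding ideal_class_ring_iff by blast
    thus ?thesis by simp
  qed
  thus ?thesis unfolding primitive_poly_def genideal_def by auto
qed

lemma primitive_poly_monom_1 [simp]: "primitive_poly (monom 1 k)"
proof (rule primitive_polyI)
  fix I :: "'a set" assume "range (coeff (monom 1 k)) \<subseteq> I"
  moreover have "coeff (monom 1 k) k = (1::'a)" by simp
  ultimately show "1 \<in> I" by (metis rangeI subsetD)
qed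

lemma primitive_poly_1 [simp]: "primitive_poly 1"
  using primitive_poly_monom_1[of 0] by (simp add: monom_0 one_pCons)

lemma primitive_poly_X [simp]: "primitive_poly [:0, 1:]"
  using primitive_poly_monom_1[of 1] by (simp add: monom_altdef)

lemma not_primitive_poly_0 [simp]: "\<not> primitive_poly 0"
proof
  assume "primitive_poly (0 :: 'a poly)"
  moreover have "ideal {0} (class_ring :: 'a ring)"
    by (simp add: ideal_class_ring_iff)
  ultimately have "{0 :: 'a} = UNIV"
    by (rule primitive_polyD) auto
  thus False by (metis UNIV_I singletonD zero_neq_one)
qed

lemma primitive_poly_mult_coeff_mem:
  fixes f g :: "'a::comm_ring_1 poly"
  assumes I: "ideal I class_ring" and f: "primitive_poly f"
    and "\<And>k. coeff (f * g) k \<in> I"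
  shows "coeff g k \<in> I"
proof -
  have *: "\<And>k. coeff g k \<in> I"
    if "\<And>k. k \<ge> d \<Longrightarrow> coeff g k \<in> I" "\<And>k. coeff (f * g) k \<in> I" for d and g :: "'a poly"
    using that
  proof (induction d arbitrary: g)
    case 0
    thus ?case by simp
  next
    case (Suc d)
    have step: "coeff f i * coeff g k \<in> I" for i k
    proof (induction "degree f - i" arbitrary: i k rule: less_induct)
      case less
      show ?case
      proof (cases "i \<le> degree f")
        case False
        thus ?thesis using I by (simp add: coeff_eq_0 ideal_class_ring_iff)
      next
        case True
        have above: "coeff f j * coeff g l \<in> I" if "i < j" for j l
        proof (cases "j \<le> degree f")
          case True
          thus ?thesis using that less by auto
        next
          case False
          thus ?thesis using I by (simp add: coeff_eq_0 ideal_class_ring_iff)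
        qed
        have rest: "coeff f j * coeff g (i + d - j) \<in> I" if "j \<in> {..i+d} - {i}" for j
        proof (cases "i < j")
          case True
          thus ?thesis by (rule above)
        next
          case False
          hence "Suc d \<le> i + d - j" using that by auto
          hence "coeff g (i + d - j) \<in> I" by (rule Suc.prems(1))
          thus ?thesis using I unfolding ideal_class_ring_iff by blast
        qed
        have "coeff (f * g) (i + d) =
            coeff f i * coeff g d + (\<Sum>j\<in>{..i+d} - {i}. coeff f j * coeff g (i + d - j))"
          by (simp add: coeff_mult sum.remove[of _ i])
        hence "coeff f i * coeff g d =
            coeff (f * g) (i + d) - (\<Sum>j\<in>{..i+d} - {i}. coeff f j * coeff g (i + d - j))"
          by simp
        also have "\<dots> \<in> I"
          by (intro ideal_diff_mem[OF I] Suc.prems(2) ideal_sum_mem[OF I] rest)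
        finally have top: "coeff f i * coeff g d \<in> I" .
        have "coeff (Polynomial.smult (coeff f i) g) k \<in> I"
        proof (rule Suc.IH)
          fix l assume "d \<le> l"
          show "coeff (Polynomial.smult (coeff f i) g) l \<in> I"
          proof (cases "l = d")
            case True
            thus ?thesis using top by simp
          next
            case False
            hence "coeff g l \<in> I" using \<open>d \<le> l\<close> by (intro Suc.prems(1)) auto
            thus ?thesis using I by (simp add: ideal_class_ring_iff)
          qed
        next
          fix l
          show "coeff (f * Polynomial.smult (coeff f i) g) l \<in> I"
            using Suc.prems(2)[of l] I by (simp add: ideal_class_ring_iff)
        qed
        thus ?thesis by simp
      qed
    qed
    let ?J = "{c. \<forall>k. c * coeff g k \<in> I}"
    have "ideal ?J class_ring"
      using I unfolding ideal_class_ring_iff by (auto simp: distrib_right mult.assoc)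
    hence "?J = UNIV"
      by (rule primitive_polyD[OF f]) (use step in auto)
    hence "1 \<in> ?J" by blast
    thus ?case by simp
  qed
  show ?thesis
  proof (rule *[of "Suc (degree g)"])
    fix k assume "Suc (degree g) \<le> k"
    thus "coeff g k \<in> I" using I by (simp add: coeff_eq_0 ideal_class_ring_iff)
  qed (rule assms(3))
qed

lemma primitive_poly_mult [simp]:
  assumes "primitive_poly p" "primitive_poly q"
  shows "primitive_poly (p * q)"
proof (rule primitive_polyI)
  fix I :: "'a set"
  assume I: "ideal I class_ring" "range (coeff (p * q)) \<subseteq> I"
  have "coeff q k \<in> I" for k
    by (rule primitive_poly_mult_coeff_mem[OF I(1) assms(1)]) (use I(2) in auto)
  hence "range (coeff q) \<subseteq> I" by blast
  hence "I = UNIV" by (rule primitive_polyD[OF assms(2) I(1)])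
  thus "1 \<in> I" by simp
qed

lemma primitive_poly_mult_eq_0_iff:
  fixes p :: "'a::comm_ring_1 poly"
  assumes "primitive_poly p"
  shows "p * q = 0 \<longleftrightarrow> q = 0"
proof
  assume "p * q = 0"
  hence *: "coeff (p * q) k \<in> {0}" for k by simp
  have "ideal {0} (class_ring :: 'a ring)" by (simp add: ideal_class_ring_iff)
  hence "coeff q k \<in> {0}" for k
    using assms * by (rule primitive_poly_mult_coeff_mem)
  thus "q = 0" by (intro poly_eqI) simp
qed simp


section \<open>The ring $A(t) = S^{-1}A[t]$\<close>

text \<open>
  \<open>'a nagata\<close> is the localization of \<open>'a poly\<close> at the multiplicative set of
  primitive polynomials.
\<close>

definition nagata_rel :: "'a::comm_ring_1 poly \<times> 'a poly \<Rightarrow> 'a poly \<times> 'a poly \<Rightarrow> bool" where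
  "nagata_rel x y \<longleftrightarrow> primitive_poly (snd x) \<and> primitive_poly (snd y) \<and>
     (\<exists>w. primitive_poly w \<and> w * (fst x * snd y) = w * (fst y * snd x))"

lemma nagata_rel_iff [simp]:
  fixes x y :: "'a::comm_ring_1 poly \<times> 'a poly"
  shows "nagata_rel x y \<longleftrightarrow>
     primitive_poly (snd x) \<and> primitive_poly (snd y) \<and> fst x * snd y = fst y * snd x"
proof -
  have cancel: "a = b" if "primitive_poly w" "w * a = w * b" for w a b :: "'a poly"
  proof -
    have "w * (a - b) = 0" using that by (simp add: right_diff_distrib)
    hence "a - b = 0" using primitive_poly_mult_eq_0_iff[OF that(1)] by blast
    thus ?thesis by simp
  qed
  have "(\<exists>w. primitive_poly w \<and> w * a = w * b) \<longleftrightarrow> a = b" for a b :: "'a poly"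
    using cancel primitive_poly_1 by blast
  thus ?thesis unfolding nagata_rel_def by blast
qed

lemma part_equivp_nagata_rel:
  "part_equivp (nagata_rel :: 'a::comm_ring_1 poly \<times> 'a poly \<Rightarrow> _)"
proof (rule part_equivpI)
  show "\<exists>x :: 'a poly \<times> 'a poly. nagata_rel x x" by (rule exI[of _ "(0, 1)"]) simp
  show "symp (nagata_rel :: 'a poly \<times> 'a poly \<Rightarrow> _)" by (simp add: symp_def)
  show "transp (nagata_rel :: 'a poly \<times> 'a poly \<Rightarrow> _)"
  proof (rule transpI, unfold split_paired_all)
    fix a b a' b' a'' b'' :: "'a poly"
    assume A: "nagata_rel (a, b) (a', b')" and B: "nagata_rel (a', b') (a'', b'')"
    have "b' * (a * b'') = b'' * (a * b')" by (simp add: ac_simps)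
    also have "a * b' = a' * b" using A by auto
    also have "b'' * (a' * b) = b * (a' * b'')" by (simp add: ac_simps)
    also have "a' * b'' = a'' * b'" using B by auto
    also have "b * (a'' * b') = b' * (a'' * b)" by (simp add: ac_simps)
    finally show "nagata_rel (a, b) (a'', b'')"
      using A B unfolding nagata_rel_def by auto
  qed
qed

quotient_type (overloaded) 'a nagata = "'a::comm_ring_1 poly \<times> 'a poly" / partial: nagata_rel
  by (rule part_equivp_nagata_rel)

text \<open>\<open>NFract p s\<close> is the fraction $p/s$; it is meaningful only for primitive \<open>s\<close>.\<close>

lift_definition NFract :: "'a::comm_ring_1 poly \<Rightarrow> 'a poly \<Rightarrow> 'a nagata"
  is "\<lambda>p s. if primitive_poly s then (p, s) else (0, 1)"
  by simp

lemma nagata_cases [cases type: nagata]: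
  obtains (NFract) p s where "x = NFract p s" "primitive_poly s"
  by transfer simp

lemma NFract_eq_iff:
  assumes "primitive_poly s" "primitive_poly u"
  shows "NFract p s = NFract q u \<longleftrightarrow> p * u = q * s"
  using assms by transfer simp

instantiation nagata :: (comm_ring_1) comm_ring_1
begin

lift_definition zero_nagata :: "'a nagata" is "(0, 1)" by simp

lift_definition one_nagata :: "'a nagata" is "(1, 1)" by simp

lift_definition plus_nagata :: "'a nagata \<Rightarrow> 'a nagata \<Rightarrow> 'a nagata"
  is "\<lambda>x y. (fst x * snd y + fst y * snd x, snd x * snd y)"
proof -
  fix x x' y y' :: "'a poly \<times> 'a poly"
  assume A: "nagata_rel x x'" and B: "nagata_rel y y'"
  have a: "fst x * snd x' = fst x' * snd x" and b: "fst y * snd y' = fst y' * snd y"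
    using A B by auto
  have "(fst x * snd y + fst y * snd x) * (snd x' * snd y') =
      (fst x * snd x') * (snd y * snd y') + (fst y * snd y') * (snd x * snd x')"
    by (simp add: algebra_simps)
  also have "\<dots> = (fst x' * snd y' + fst y' * snd x') * (snd x * snd y)"
    unfolding a b by (simp add: algebra_simps)
  finally show "nagata_rel (fst x * snd y + fst y * snd x, snd x * snd y)
      (fst x' * snd y' + fst y' * snd x', snd x' * snd y')"
    using A B by simp
qed

lift_definition uminus_nagata :: "'a nagata \<Rightarrow> 'a nagata"
  is "\<lambda>x. (- fst x, snd x)" by simp

definition minus_nagata :: "'a nagata \<Rightarrow> 'a nagata \<Rightarrow> 'a nagata" where
  "minus_nagata x y = x + - y"

lift_definition times_nagata :: "'a nagata \<Rightarrow> 'a nagata \<Rightarrow> 'a nagata"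
  is "\<lambda>x y. (fst x * fst y, snd x * snd y)"
proof -
  fix x x' y y' :: "'a poly \<times> 'a poly"
  assume A: "nagata_rel x x'" and B: "nagata_rel y y'"
  have a: "fst x * snd x' = fst x' * snd x" and b: "fst y * snd y' = fst y' * snd y"
    using A B by auto
  have "(fst x * fst y) * (snd x' * snd y') = (fst x * snd x') * (fst y * snd y')"
    by (simp add: ac_simps)
  also have "\<dots> = (fst x' * fst y') * (snd x * snd y)"
    unfolding a b by (simp add: ac_simps)
  finally show "nagata_rel (fst x * fst y, snd x * snd y) (fst x' * fst y', snd x' * snd y')"
    using A B by simp
qed

lemma zero_nagata_NFract: "0 = NFract 0 1"
  by transfer simp

lemma one_nagata_NFract: "1 = NFract 1 1"
  by transfer simp

lemma add_NFract:
  "primitive_poly s \<Longrightarrow> primitive_poly u \<Longrightarrow>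
    NFract p s + NFract q u = NFract (p * u + q * s) (s * u)"
  by transfer simp

lemma uminus_NFract: "primitive_poly s \<Longrightarrow> - NFract p s = NFract (- p) s"
  by transfer simp

lemma mult_NFract:
  "primitive_poly s \<Longrightarrow> primitive_poly u \<Longrightarrow> NFract p s * NFract q u = NFract (p * q) (s * u)"
  by transfer simp

instance
proof
  fix x y z :: "'a nagata"
  note NF = NFract_eq_iff add_NFract uminus_NFract mult_NFract
    zero_nagata_NFract one_nagata_NFract minus_nagata_def
  show "x * y * z = x * (y * z)"
    by (cases x; cases y; cases z) (simp add: NF algebra_simps)
  show "x * y = y * x"
    by (cases x; cases y) (simp add: NF algebra_simps)
  show "1 * x = x"
    by (cases x) (simp add: NF)
  show "x + y + z = x + (y + z)"
    by (cases x; cases y; cases z) (simp add: NF algebra_simps)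
  show "x + y = y + x"
    by (cases x; cases y) (simp add: NF algebra_simps)
  show "0 + x = x"
    by (cases x) (simp add: NF)
  show "- x + x = 0"
    by (cases x) (simp add: NF)
  show "x - y = x + - y"
    by (rule minus_nagata_def)
  show "(x + y) * z = x * z + y * z"
    by (cases x; cases y; cases z) (simp add: NF algebra_simps)
  show "(0 :: 'a nagata) \<noteq> 1"
    by (simp add: NF)
qed

end

definition nagata_const :: "'a::comm_ring_1 \<Rightarrow> 'a nagata" where
  "nagata_const a = NFract [:a:] 1"

definition nagata_t :: "'a::comm_ring_1 nagata" where
  "nagata_t = NFract [:0, 1:] 1"

definition nagata_t_inv :: "'a::comm_ring_1 nagata" where
  "nagata_t_inv = NFract 1 [:0, 1:]"

lemma nagata_t_inv: "nagata_t * nagata_t_inv = 1" "nagata_t_inv * nagata_t = 1"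
  unfolding nagata_t_def nagata_t_inv_def
  by (simp_all add: mult_NFract one_nagata_NFract NFract_eq_iff)


section \<open>Linear maps given by matrices\<close>

definition mat_image :: "'a::comm_ring_1 mat \<Rightarrow> 'a vec set" where
  "mat_image A = (\<lambda>v. A *\<^sub>v v) ` carrier_vec (dim_col A)"

definition direct_sum_decomp :: "nat \<Rightarrow> 'a::comm_ring_1 vec set \<Rightarrow> 'a vec set \<Rightarrow> bool" where
  "direct_sum_decomp d N P \<longleftrightarrow>
     LinearCombinations.submodule class_ring N (module_vec TYPE('a) d) \<and>
     LinearCombinations.submodule class_ring P (module_vec TYPE('a) d) \<and>
     {x + y | x y. x \<in> N \<and> y \<in> P} = carrier_vec d \<and> N \<inter> P = {0\<^sub>v d}"

definition locally_simple :: "'a::comm_ring_1 mat \<Rightarrow> bool" where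
  "locally_simple A \<longleftrightarrow> (\<exists>P. direct_sum_decomp (dim_row A) (mat_image A) P)"

text \<open>\<open>mat_of_cols d es *\<^sub>v c\<close> is the linear combination of the list \<open>es\<close> with coefficients \<open>c\<close>.\<close>

definition free_basis :: "nat \<Rightarrow> 'a::comm_ring_1 vec list \<Rightarrow> bool" where
  "free_basis d es \<longleftrightarrow> length es = d \<and> set es \<subseteq> carrier_vec d \<and>
     (\<forall>v\<in>carrier_vec d. \<exists>!c. c \<in> carrier_vec d \<and> mat_of_cols d es *\<^sub>v c = v)"

text \<open>Indices start at \<open>0\<close>.\<close>

definition quasi_simple :: "'a::comm_ring_1 mat \<Rightarrow> bool" where
  "quasi_simple A \<longleftrightarrow>
    (let m = dim_row A; n = dim_col A in
     \<exists>es fs r. free_basis n es \<and> free_basis m fs \<and>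
       (\<forall>i < min m n. r i * r i = r i) \<and>
       (\<forall>i. Suc i < min m n \<longrightarrow> r i * r (Suc i) = r (Suc i)) \<and>
       (\<forall>i < min m n. A *\<^sub>v (es ! i) = r i \<cdot>\<^sub>v (fs ! i)) \<and>
       (\<forall>i. min m n \<le> i \<and> i < n \<longrightarrow> A *\<^sub>v (es ! i) = 0\<^sub>v m))"

definition crossed :: "'a::comm_ring_1 mat \<Rightarrow> 'a mat \<Rightarrow> bool" where
  "crossed A B \<longleftrightarrow>
     direct_sum_decomp (dim_row A) (mat_image A) (mat_kernel B) \<and>
     direct_sum_decomp (dim_col A) (mat_kernel A) (mat_image B)"


section \<open>The matrix $A^\circ$\<close>

definition Q_mat :: "nat \<Rightarrow> 'a::comm_ring_1 nagata mat" where
  "Q_mat r = mat_diag r (\<lambda>i. nagata_t ^ i)"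

definition Q_mat_inv :: "nat \<Rightarrow> 'a::comm_ring_1 nagata mat" where
  "Q_mat_inv r = mat_diag r (\<lambda>i. nagata_t_inv ^ i)"

lemma Q_mat_inv:
  "inverts_mat (Q_mat r :: 'a::comm_ring_1 nagata mat) (Q_mat_inv r)"
  "inverts_mat (Q_mat_inv r :: 'a nagata mat) (Q_mat r)"
proof -
  have "dim_row (Q_mat r :: 'a nagata mat) = r" "dim_row (Q_mat_inv r :: 'a nagata mat) = r"
    unfolding Q_mat_def Q_mat_inv_def mat_diag_def by simp_all
  thus "inverts_mat (Q_mat r :: 'a nagata mat) (Q_mat_inv r)"
    "inverts_mat (Q_mat_inv r :: 'a nagata mat) (Q_mat r)"
    unfolding inverts_mat_def
    by (simp_all add: Q_mat_def Q_mat_inv_def nagata_t_inv flip: power_mult_distrib)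
qed

definition mat_circ :: "'a::comm_ring_1 mat \<Rightarrow> 'a nagata mat" where
  "mat_circ A =
     Q_mat_inv (dim_col A) * transpose_mat (map_mat nagata_const A) * Q_mat (dim_row A)"

lemma mat_circ_carrier: "A \<in> carrier_mat m n \<Longrightarrow> mat_circ A \<in> carrier_mat n m"
  unfolding mat_circ_def Q_mat_def Q_mat_inv_def mat_diag_def by auto

lemma mat_circ_index:
  assumes "i < dim_col A" "j < dim_row A"
  shows "mat_circ A $$ (i, j) = nagata_t_inv ^ i * nagata_const (A $$ (j, i)) * nagata_t ^ j"
proof -
  let ?T = "transpose_mat (map_mat nagata_const A)"
  have T: "?T \<in> carrier_mat (dim_col A) (dim_row A)" by simp
  have QT: "Q_mat_inv (dim_col A) * ?T =
      mat (dim_col A) (dim_row A) (\<lambda>(i, j). nagata_t_inv ^ i * ?T $$ (i, j))" (is "_ = ?M")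
    unfolding Q_mat_inv_def by (rule mat_diag_mult_left[OF T])
  have "?M * Q_mat (dim_row A) =
      mat (dim_col A) (dim_row A) (\<lambda>(i, j). ?M $$ (i, j) * nagata_t ^ j)"
    unfolding Q_mat_def by (rule mat_diag_mult_right) simp
  thus ?thesis using assms unfolding mat_circ_def QT by simp
qed

end

theory Submission
  imports Defs "Jordan_Normal_Form.Determinant"
begin

text \<open>
  Write \<open>C\<close> for \<open>A\<close> regarded as a matrix over $\mathbf{A}(t)$. Over any commutative ring a matrix \<open>M\<close> is locally
  simple iff \<open>M * B * M = M\<close> for some \<open>B\<close> (\<open>locally_simple_iff\<close>). If \<open>C * B * C = C\<close>, clear the denominators of
  \<open>B\<close> and compare the coefficients of each power of \<open>t\<close>: this gives \<open>A * B\<^sub>k * A = s\<^sub>k A\<close>, where the \<open>s\<^sub>k\<close> are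
  the coefficients of a primitive polynomial, and a linear combination of these equations is \<open>A * B' * A = A\<close>
  (\<open>locally_simple_nagata_iff\<close>).

  The feature of $\mathbf{A}(t)$ behind the other equivalences is that units are easy to produce. For elements
  \<open>c\<^sub>0, c\<^sub>1, \<dots>\<close> with a common denominator and \<open>N\<close> larger than the degrees of the numerators, the numerator of
  $\sum_i t^{N i} c_i$ lists the coefficients of all the numerators without overlap. So this sum is a unit
  unless some proper ideal \<open>I\<close> of $\mathbf{A}$ contains all those coefficients (\<open>spread_unit\<close>).

  For the quasi-simple form: if \<open>C * B * C = C\<close>, the ideal of the entries of \<open>C\<close> is idempotent and finitely generated, hence
  generated by an idempotent \<open>e\<close>. Spreading the entries of \<open>C\<close> together with \<open>1 - e\<close> gives a unit; multiplied by
  \<open>e\<close> this says that some $x^{\mathrm T} C y$ is \<open>e\<close> times a unit, where \<open>x\<close> and \<open>y\<close> have first coordinate 1. Hence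
  \<open>C\<close> is equivalent to a matrix with \<open>e\<close> in the corner; \<open>e\<close> divides all entries, so the first row and column
  can be cleared, and induction applies to the remaining block (\<open>regular_equiv_diag\<close>). Conversely, a diagonal
  matrix of idempotents \<open>D\<close> satisfies \<open>D * E * D = D\<close> for the rectangular identity \<open>E\<close>.

  For crossed maps, assume \<open>A * B * A = A\<close> and let \<open>D\<close> be a diagonal matrix of pairwise distinct powers of \<open>t\<close>. The point
  is that the symmetric form \<open>D\<close> is nondegenerate on the image of \<open>C\<close>, in the form \<open>L * (C\<^sup>T * D * C) = C\<close> for some
  \<open>L\<close> (\<open>gram_left_cancel\<close>). Modulo an ideal \<open>I\<close> with \<open>a\<^sup>2 \<in> I \<Longrightarrow> a \<in> I\<close> this is anisotropy: if a polynomial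
  vector \<open>y\<close> lies in the image of \<open>A\<close> and is orthogonal to that image, pair its lowest nonzero coefficient
  vector \<open>y\<^sub>k\<close>, which again lies in the image, with \<open>y\<close>; the lowest term of the result is the square of the nonzero
  entry of \<open>y\<^sub>k\<close> of least weight in \<open>D\<close>, a contradiction (\<open>weighted_form_anisotropic\<close>). Injectivity modulo all such ideals yields
  a left inverse over $\mathbf{A}(t)$ by column elimination with pivots from \<open>spread_unit\<close>
  (\<open>left_inverse_from_injectivity\<close>). Using this for \<open>A\<close> with \<open>Q\<^sub>m\<close> and for \<open>A\<^sup>T\<close> with
  $t^{n-1} Q_n^{-1}$ gives both decompositions in the definition of crossed maps; conversely, the first of
  them already says that \<open>C\<close> is locally simple.
\<close>

section \<open>Fractions and common denominators\<close>

definition nagata_poly :: "'a::comm_ring_1 poly \<Rightarrow> 'a nagata" where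
  "nagata_poly p = NFract p 1"

lemma nagata_poly_add: "nagata_poly (p + q) = nagata_poly p + nagata_poly q"
  by (simp add: nagata_poly_def add_NFract)

lemma nagata_poly_mult: "nagata_poly (p * q) = nagata_poly p * nagata_poly q"
  by (simp add: nagata_poly_def mult_NFract)

lemma nagata_poly_0 [simp]: "nagata_poly 0 = 0"
  by (simp add: nagata_poly_def zero_nagata_NFract)

lemma nagata_poly_1 [simp]: "nagata_poly 1 = 1"
  by (simp add: nagata_poly_def one_nagata_NFract)

lemma nagata_poly_inject [simp]: "nagata_poly p = nagata_poly q \<longleftrightarrow> p = q"
  by (simp add: nagata_poly_def NFract_eq_iff)

lemma nagata_poly_sum: "nagata_poly (sum f S) = (\<Sum>i\<in>S. nagata_poly (f i))"
  by (induction S rule: infinite_finite_induct) (simp_all add: nagata_poly_add)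

lemma nagata_poly_power: "nagata_poly (p ^ k) = nagata_poly p ^ k"
  by (induction k) (simp_all add: nagata_poly_mult)

lemma nagata_const_poly: "nagata_const a = nagata_poly [:a:]"
  by (simp add: nagata_const_def nagata_poly_def)

lemma nagata_t_power: "nagata_t ^ k = nagata_poly (monom 1 k)"
  by (simp add: nagata_t_def monom_altdef nagata_poly_power flip: nagata_poly_def)

lemma comm_ring_hom_nagata_const: "comm_ring_hom nagata_const"
proof
  fix a b :: 'a
  show "nagata_const (a + b) = nagata_const a + nagata_const b"
    by (simp add: nagata_const_poly flip: nagata_poly_add)
  show "nagata_const (a * b) = nagata_const a * nagata_const b"
    by (simp add: nagata_const_poly flip: nagata_poly_mult)
qed (simp_all add: nagata_const_poly flip: one_pCons)

lemma primitive_poly_unit: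
  assumes "primitive_poly s"
  shows "\<exists>u. u * nagata_poly s = 1"
  using assms by (intro exI[of _ "NFract 1 s"])
    (simp add: nagata_poly_def mult_NFract one_nagata_NFract NFract_eq_iff)

lemma common_denominator:
  fixes c :: "nat \<Rightarrow> 'a::comm_ring_1 nagata"
  shows "\<exists>s p. primitive_poly s \<and> (\<forall>i<k. nagata_poly s * c i = nagata_poly (p i))"
proof (induction k)
  case 0
  show ?case by (intro exI[of _ 1]) simp
next
  case (Suc k)
  then obtain s p where sp: "primitive_poly s" "\<forall>i<k. nagata_poly s * c i = nagata_poly (p i)"
    by blast
  obtain q u where qu: "c k = NFract q u" "primitive_poly u" by (cases "c k")
  have u: "nagata_poly u * c k = nagata_poly q"
    using qu by (simp add: nagata_poly_def mult_NFract NFract_eq_iff)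
  show ?case
  proof (intro exI conjI allI impI)
    show "primitive_poly (s * u)" using sp(1) qu(2) by simp
    fix i assume "i < Suc k"
    thus "nagata_poly (s * u) * c i = nagata_poly (if i = k then s * q else u * p i)"
      by (cases "i = k") (simp_all add: nagata_poly_mult sp(2)[rule_format, symmetric] u[symmetric] mult_ac)
  qed
qed

section \<open>Extended ideals and the construction of units\<close>

text \<open>
  For an ideal \<open>I\<close> this is $I \mathbf{A}(t)$, in a form that allows membership to be decided on any single fraction.
\<close>

definition ext_ideal :: "'a::comm_ring_1 set \<Rightarrow> 'a nagata set" where
  "ext_ideal I = {c. \<exists>s p. primitive_poly s \<and> nagata_poly s * c = nagata_poly p \<and>
     (\<forall>k. coeff p k \<in> I)}"

lemma ideal_mem:
  fixes I :: "'a::comm_ring_1 set"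
  assumes "ideal I class_ring"
  shows "0 \<in> I" "a \<in> I \<Longrightarrow> b \<in> I \<Longrightarrow> a + b \<in> I" "a \<in> I \<Longrightarrow> x * a \<in> I" "a \<in> I \<Longrightarrow> a * x \<in> I"
  using assms unfolding ideal_class_ring_iff by (auto simp: mult.commute)

lemma ideal_coeff_mult:
  fixes I :: "'a::comm_ring_1 set"
  assumes "ideal I class_ring" "\<And>k. coeff p k \<in> I"
  shows "coeff (q * p) k \<in> I"
  unfolding coeff_mult using assms by (intro ideal_sum_mem[OF assms(1)] ideal_mem(3))

text \<open>
  Membership does not depend on the chosen fraction, because a primitive factor can be cancelled modulo \<open>I\<close>.
\<close>

lemma ext_ideal_iff:
  assumes I: "ideal I class_ring" and s: "primitive_poly s" and c: "nagata_poly s * c = nagata_poly p"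
  shows "c \<in> ext_ideal I \<longleftrightarrow> (\<forall>k. coeff p k \<in> I)"
proof
  assume "c \<in> ext_ideal I"
  then obtain s' p' where s': "primitive_poly s'" "nagata_poly s' * c = nagata_poly p'"
    "\<And>k. coeff p' k \<in> I" unfolding ext_ideal_def by blast
  have "nagata_poly (s' * p) = nagata_poly (s * p')"
    unfolding nagata_poly_mult s'(2)[symmetric] c[symmetric] by (simp add: ac_simps)
  hence "s' * p = s * p'" by simp
  hence "coeff (s' * p) k \<in> I" for k using ideal_coeff_mult[OF I s'(3)] by metis
  thus "\<forall>k. coeff p k \<in> I" using primitive_poly_mult_coeff_mem[OF I s'(1)] by blast
qed (use s c in \<open>auto simp: ext_ideal_def\<close>)

lemma ext_ideal_ideal:
  assumes I: "ideal I class_ring"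
  shows "ideal (ext_ideal I) class_ring"
  unfolding ideal_class_ring_iff
proof (intro conjI ballI allI)
  show "0 \<in> ext_ideal I" using ext_ideal_iff[OF I, of 1 0 0] ideal_mem(1)[OF I] by simp
next
  fix a b assume ab: "a \<in> ext_ideal I" "b \<in> ext_ideal I"
  obtain s p where sp: "primitive_poly s"
    "\<forall>i<2::nat. nagata_poly s * (if i = 0 then a else b) = nagata_poly (p i)"
    using common_denominator[where c = "\<lambda>i. if i = 0 then a else b"] by blast
  have a: "nagata_poly s * a = nagata_poly (p 0)" and b: "nagata_poly s * b = nagata_poly (p 1)"
    using sp(2)[rule_format, of 0] sp(2)[rule_format, of 1] by simp_all
  have "nagata_poly s * (a + b) = nagata_poly (p 0 + p 1)"
    by (simp add: distrib_left a b nagata_poly_add)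
  moreover have "\<forall>k. coeff (p 0 + p 1) k \<in> I"
    using ab ext_ideal_iff[OF I sp(1) a] ext_ideal_iff[OF I sp(1) b] ideal_mem(2)[OF I] by simp
  ultimately show "a + b \<in> ext_ideal I" using ext_ideal_iff[OF I sp(1)] by blast
next
  fix a x :: "'a nagata" assume "a \<in> ext_ideal I"
  then obtain s p where sp: "primitive_poly s" "nagata_poly s * a = nagata_poly p"
    "\<And>k. coeff p k \<in> I" unfolding ext_ideal_def by blast
  obtain q u where qu: "x = NFract q u" "primitive_poly u" by (cases x)
  have u: "nagata_poly u * x = nagata_poly q"
    using qu by (simp add: nagata_poly_def mult_NFract NFract_eq_iff)
  have "nagata_poly (u * s) * (x * a) = (nagata_poly u * x) * (nagata_poly s * a)"
    by (simp add: nagata_poly_mult ac_simps)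
  also have "\<dots> = nagata_poly (q * p)" unfolding u sp(2) by (simp add: nagata_poly_mult)
  finally show "x * a \<in> ext_ideal I"
    using ext_ideal_iff[OF I, of "u * s"] sp qu ideal_coeff_mult[OF I] by simp
qed

lemma one_in_ext_ideal:
  assumes "ideal I class_ring" "1 \<in> ext_ideal I"
  shows "1 \<in> I"
proof -
  have "\<forall>k. coeff (1 :: 'a poly) k \<in> I"
    using ext_ideal_iff[OF assms(1), of 1 1 1] assms(2) by simp
  from spec[OF this, of 0] show ?thesis by simp
qed

text \<open>
  Multiplying the \<open>i\<close>-th polynomial by \<open>t^(N * i)\<close> puts its coefficients into the \<open>i\<close>-th window of length \<open>N\<close>,
  so that no two of the polynomials interfere.
\<close>

lemma coeff_spread:
  fixes p :: "nat \<Rightarrow> 'a::comm_ring_1 poly"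
  assumes deg: "\<And>i. i < k \<Longrightarrow> degree (p i) < N" and i: "i < k"  and d: "d < N"
  shows "coeff (\<Sum>i<k. monom 1 (N * i) * p i) (N * i + d) = coeff (p i) d"
proof -
  have "coeff (\<Sum>j<k. monom 1 (N * j) * p j) (N * i + d) =
      (\<Sum>j<k. if j = i then coeff (p i) d else 0)"
    unfolding coeff_sum
  proof (rule sum.cong[OF refl])
    fix j assume j: "j \<in> {..<k}"
    consider "j < i" | "j = i" | "j > i" by linarith
    thus "coeff (monom 1 (N * j) * p j) (N * i + d) = (if j = i then coeff (p i) d else 0)"
    proof cases
      case 1
      have "N * Suc j \<le> N * i" by (rule mult_le_mono2) (use 1 in simp)
      hence "N \<le> N * i + d - N * j" by simp
      hence "degree (p j) < N * i + d - N * j" using deg[of j] j by simp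
      thus ?thesis using 1 by (simp add: coeff_monom_mult coeff_eq_0)
    next
      case 3
      have "N * Suc i \<le> N * j" by (rule mult_le_mono2) (use 3 in simp)
      hence "\<not> N * j \<le> N * i + d" using d by simp
      thus ?thesis using 3 by (simp add: coeff_monom_mult)
    qed (simp add: coeff_monom_mult)
  qed
  thus ?thesis using i by simp
qed

text \<open>
  This replaces, for $\mathbf{A}(t)$, the choice of a unit among finitely many elements of a local ring:
  the hypothesis says that the coefficients of the numerators generate the unit ideal, so the spread-out
  numerator is primitive. The exponent \<open>N\<close> only has to exceed the degrees.
\<close>

lemma spread_unit:
  fixes c :: "nat \<Rightarrow> 'a::comm_ring_1 nagata"
  assumes "\<And>I. ideal I (class_ring :: 'a ring) \<Longrightarrow> (\<And>i. i < k \<Longrightarrow> c i \<in> ext_ideal I) \<Longrightarrow> 1 \<in> I"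
  shows "\<exists>N u. u * (\<Sum>i<k. nagata_t ^ (N * i) * c i) = 1"
proof -
  obtain s p where sp: "primitive_poly s" "\<forall>i<k. nagata_poly s * c i = nagata_poly (p i)"
    using common_denominator by blast
  define N where "N = Suc (\<Sum>i<k. degree (p i))"
  have deg: "degree (p i) < N" if "i < k" for i
    using member_le_sum[of i "{..<k}" "\<lambda>i. degree (p i)"] that unfolding N_def by simp
  let ?q = "\<Sum>i<k. monom 1 (N * i) * p i"
  have "primitive_poly ?q"
  proof (rule primitive_polyI)
    fix I :: "'a set" assume I: "ideal I class_ring" "range (coeff ?q) \<subseteq> I"
    show "1 \<in> I"
    proof (rule assms[OF I(1)])
      fix i assume i: "i < k"
      have "coeff (p i) d \<in> I" for d
      proof (cases "d < N")
        case True
        have "coeff ?q (N * i + d) = coeff (p i) d"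
          by (rule coeff_spread) (use deg i True in auto)
        moreover have "coeff ?q (N * i + d) \<in> I" using I(2) by blast
        ultimately show ?thesis by simp
      next
        case False
        thus ?thesis using deg[OF i] ideal_mem(1)[OF I(1)] by (simp add: coeff_eq_0)
      qed
      thus "c i \<in> ext_ideal I" using ext_ideal_iff[OF I(1) sp(1)] sp(2) i by blast
    qed
  qed
  then obtain u where u: "u * nagata_poly ?q = 1" using primitive_poly_unit by blast
  have "nagata_poly ?q = nagata_poly s * (\<Sum>i<k. nagata_t ^ (N * i) * c i)"
    unfolding nagata_poly_sum sum_distrib_left
    by (rule sum.cong) (simp_all add: nagata_poly_mult nagata_t_power sp(2)[rule_format, symmetric] mult_ac)
  with u have "(u * nagata_poly s) * (\<Sum>i<k. nagata_t ^ (N * i) * c i) = 1"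
    by (simp add: mult.assoc)
  thus ?thesis by blast
qed

section \<open>Locally simple matrices and generalized inverses\<close>

lemma submodule_vec_iff:
  fixes N :: "'a::comm_ring_1 vec set"
  shows "LinearCombinations.submodule class_ring N (module_vec TYPE('a) d) \<longleftrightarrow>
    N \<subseteq> carrier_vec d \<and> 0\<^sub>v d \<in> N \<and> (\<forall>x\<in>N. \<forall>y\<in>N. x + y \<in> N) \<and> (\<forall>c. \<forall>x\<in>N. c \<cdot>\<^sub>v x \<in> N)"
proof -
  interpret vec_module "TYPE('a)" d .
  show ?thesis
    unfolding LinearCombinations.submodule_def using module_axioms
    by (auto simp: module_vec_simps)
qed

lemma mult_mat_smult_vec:
  fixes A :: "'a::comm_ring_1 mat"
  assumes "A \<in> carrier_mat m n" "v \<in> carrier_vec n"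
  shows "A *\<^sub>v (k \<cdot>\<^sub>v v) = k \<cdot>\<^sub>v (A *\<^sub>v v)"
  using assms by (intro eq_vecI) auto

lemma submodule_mat_image:
  fixes A :: "'a::comm_ring_1 mat"
  assumes A: "A \<in> carrier_mat m n"
  shows "LinearCombinations.submodule class_ring (mat_image A) (module_vec TYPE('a) m)"
  unfolding submodule_vec_iff mat_image_def
proof (intro conjI ballI allI)
  show "0\<^sub>v m \<in> (*\<^sub>v) A ` carrier_vec (dim_col A)"
    using A by (intro image_eqI[of _ _ "0\<^sub>v n"]) auto
next
  fix x y assume "x \<in> (*\<^sub>v) A ` carrier_vec (dim_col A)" "y \<in> (*\<^sub>v) A ` carrier_vec (dim_col A)"
  then obtain u v where "x = A *\<^sub>v u" "y = A *\<^sub>v v" "u \<in> carrier_vec n" "v \<in> carrier_vec n"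
    using A by auto
  thus "x + y \<in> (*\<^sub>v) A ` carrier_vec (dim_col A)"
    using A by (intro image_eqI[of _ _ "u + v"]) (auto simp: mult_add_distrib_mat_vec)
next
  fix c x assume "x \<in> (*\<^sub>v) A ` carrier_vec (dim_col A)"
  then obtain u where "x = A *\<^sub>v u" "u \<in> carrier_vec n" using A by auto
  thus "c \<cdot>\<^sub>v x \<in> (*\<^sub>v) A ` carrier_vec (dim_col A)"
    using A by (intro image_eqI[of _ _ "c \<cdot>\<^sub>v u"]) (auto simp: mult_mat_smult_vec)
qed (use A in auto)

lemma submodule_mat_kernel:
  fixes A :: "'a::comm_ring_1 mat"
  assumes A: "A \<in> carrier_mat m n"
  shows "LinearCombinations.submodule class_ring (mat_kernel A) (module_vec TYPE('a) n)"
  unfolding submodule_vec_iff mat_kernel[OF A]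
  using A by (auto simp: mult_add_distrib_mat_vec mult_mat_smult_vec)

text \<open>
  Used to check on unit vectors that the projection assembled from their decompositions works on all vectors.
\<close>

lemma submodule_eq_carrierI:
  fixes N :: "'a::comm_ring_1 vec set"
  assumes N: "LinearCombinations.submodule class_ring N (module_vec TYPE('a) d)"
    and unit: "\<And>i. i < d \<Longrightarrow> unit_vec d i \<in> N"
  shows "N = carrier_vec d"
proof
  show "carrier_vec d \<subseteq> N"
  proof
    fix v :: "'a vec" assume v: "v \<in> carrier_vec d"
    have "vec d (\<lambda>i. if i < k then v $ i else 0) \<in> N" if "k \<le> d" for k
      using that
    proof (induction k)
      case 0
      have "vec d (\<lambda>i. if i < 0 then v $ i else 0) = 0\<^sub>v d" by (intro eq_vecI) auto
      thus ?case using N unfolding submodule_vec_iff by simp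
    next
      case (Suc k)
      have "vec d (\<lambda>i. if i < Suc k then v $ i else 0) =
          vec d (\<lambda>i. if i < k then v $ i else 0) + v $ k \<cdot>\<^sub>v unit_vec d k"
        by (intro eq_vecI) (auto simp: less_Suc_eq unit_vec_def)
      thus ?case using Suc N unit[of k] unfolding submodule_vec_iff by simp
    qed
    from this[of d] have "vec d (\<lambda>i. if i < d then v $ i else 0) \<in> N" by simp
    moreover have "vec d (\<lambda>i. if i < d then v $ i else 0) = v" using v by (intro eq_vecI) auto
    ultimately show "v \<in> N" by simp
  qed
qed (use N in \<open>auto simp: submodule_vec_iff\<close>)

lemma mat_eq_vecI:
  fixes A B :: "'a::comm_ring_1 mat"
  assumes A: "A \<in> carrier_mat m n" and B: "B \<in> carrier_mat m n"
    and eq: "\<And>v. v \<in> carrier_vec n \<Longrightarrow> A *\<^sub>v v = B *\<^sub>v v"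
  shows "A = B"
proof (rule eq_matI)
  fix i j assume "i < dim_row B" "j < dim_col B"
  hence ij: "i < m" "j < n" using B by auto
  have "(A *\<^sub>v unit_vec n j) $ i = (B *\<^sub>v unit_vec n j) $ i" using eq by simp
  thus "A $$ (i, j) = B $$ (i, j)" using ij A B by simp
qed (use A B in auto)

lemma direct_sum_decompI:
  fixes N P :: "'a::comm_ring_1 vec set"
  assumes N: "LinearCombinations.submodule class_ring N (module_vec TYPE('a) d)"
    and P: "LinearCombinations.submodule class_ring P (module_vec TYPE('a) d)"
    and sum: "\<And>v. v \<in> carrier_vec d \<Longrightarrow> \<exists>x\<in>N. v - x \<in> P"
    and int: "\<And>x. x \<in> N \<Longrightarrow> x \<in> P \<Longrightarrow> x = 0\<^sub>v d"
  shows "direct_sum_decomp d N P"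
  unfolding direct_sum_decomp_def
proof (intro conjI N P subset_antisym subsetI)
  have sub: "N \<subseteq> carrier_vec d" "P \<subseteq> carrier_vec d" using N P unfolding submodule_vec_iff by auto
  show "v \<in> carrier_vec d" if "v \<in> {x + y | x y. x \<in> N \<and> y \<in> P}" for v using that sub by (auto intro: add_carrier_vec)
  fix v :: "'a vec" assume v: "v \<in> carrier_vec d"
  then obtain x where x: "x \<in> N" "v - x \<in> P" using sum by blast
  moreover have "v = x + (v - x)" using v x sub by (intro eq_vecI) auto
  ultimately show "v \<in> {x + y | x y. x \<in> N \<and> y \<in> P}" by blast
qed (use N P int in \<open>auto simp: submodule_vec_iff\<close>)

text \<open>
  If \<open>A * B * A = A\<close>, then \<open>A * B\<close> is a projection onto the image of \<open>A\<close>, and its kernel is a complement.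
  Conversely, given a complement \<open>P\<close>, the columns of \<open>B\<close> are preimages under \<open>A\<close> of the image components of the
  unit vectors; then \<open>x - A * B x\<close> lies in \<open>P\<close> for every \<open>x\<close>, and for \<open>x\<close> in the image it also lies in the image,
  hence vanishes.
\<close>

lemma locally_simple_iff:
  fixes A :: "'a::comm_ring_1 mat"
  assumes A: "A \<in> carrier_mat m n"
  shows "locally_simple A \<longleftrightarrow> (\<exists>B\<in>carrier_mat n m. A * B * A = A)"
proof
  assume "\<exists>B\<in>carrier_mat n m. A * B * A = A"
  then obtain B where B: "B \<in> carrier_mat n m" and ABA: "A * B * A = A" by blast
  have AB: "A * B \<in> carrier_mat m m" using A B by simp
  have fixed: "A * B *\<^sub>v (A *\<^sub>v u) = A *\<^sub>v u" if "u \<in> carrier_vec n" for u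
    using assoc_mult_mat_vec[OF AB A that] ABA by simp
  have "direct_sum_decomp m (mat_image A) (mat_kernel (A * B))"
  proof (rule direct_sum_decompI[OF submodule_mat_image[OF A] submodule_mat_kernel[OF AB]])
    fix v :: "'a vec" assume v: "v \<in> carrier_vec m"
    have ABv: "A * B *\<^sub>v v = A *\<^sub>v (B *\<^sub>v v)" using A B v by simp
    have "A * B *\<^sub>v (v - A * B *\<^sub>v v) = A * B *\<^sub>v v - A * B *\<^sub>v (A * B *\<^sub>v v)"
      using AB v by (simp add: mult_minus_distrib_mat_vec)
    also have "\<dots> = 0\<^sub>v m" using fixed[of "B *\<^sub>v v"] A B v unfolding ABv by simp
    finally have "v - A * B *\<^sub>v v \<in> mat_kernel (A * B)"
      using AB v by (intro mat_kernelI) auto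
    moreover have "A * B *\<^sub>v v \<in> mat_image A" using A B v unfolding ABv mat_image_def by auto
    ultimately show "\<exists>x\<in>mat_image A. v - x \<in> mat_kernel (A * B)" by blast
  next
    fix x assume "x \<in> mat_image A" and x: "x \<in> mat_kernel (A * B)"
    then obtain u where "x = A *\<^sub>v u" "u \<in> carrier_vec n" using A unfolding mat_image_def by auto
    thus "x = 0\<^sub>v m" using fixed mat_kernelD[OF AB x] by metis
  qed
  thus "locally_simple A" using A unfolding locally_simple_def by auto
next
  assume "locally_simple A"
  then obtain P where dec: "direct_sum_decomp m (mat_image A) P"
    using A unfolding locally_simple_def by auto
  have P: "LinearCombinations.submodule class_ring P (module_vec TYPE('a) m)"
    and int: "mat_image A \<inter> P = {0\<^sub>v m}"
    and sum: "{x + y | x y. x \<in> mat_image A \<and> y \<in> P} = carrier_vec m"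
    using dec unfolding direct_sum_decomp_def by auto
  have Pc: "P \<subseteq> carrier_vec m" using P unfolding submodule_vec_iff by blast
  have "\<exists>b. b \<in> carrier_vec n \<and> unit_vec m j - A *\<^sub>v b \<in> P" if "j < m" for j
  proof -
    have "unit_vec m j \<in> {x + y | x y. x \<in> mat_image A \<and> y \<in> P}" unfolding sum by simp
    then obtain b y where b: "b \<in> carrier_vec n" "y \<in> P" "unit_vec m j = A *\<^sub>v b + y"
      using A unfolding mat_image_def by auto
    have "A *\<^sub>v b + y - A *\<^sub>v b = y" using b A Pc by (intro eq_vecI) auto
    thus ?thesis using b by auto
  qed
  then obtain b where b: "\<And>j. j < m \<Longrightarrow> b j \<in> carrier_vec n"
    "\<And>j. j < m \<Longrightarrow> unit_vec m j - A *\<^sub>v b j \<in> P" by metis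
  define B where "B = mat n m (\<lambda>(i, j). b j $ i)"
  have B: "B \<in> carrier_mat n m" by (simp add: B_def)
  have AB: "A * B \<in> carrier_mat m m" using A B by simp
  \<comment> \<open>The condition is linear in \<open>v\<close> and holds on unit vectors by the choice of \<open>B\<close>.\<close>
  let ?N = "{v \<in> carrier_vec m. v - A * B *\<^sub>v v \<in> P}"
  have "?N = carrier_vec m"
  proof (rule submodule_eq_carrierI)
    show "LinearCombinations.submodule class_ring ?N (module_vec TYPE('a) m)"
      unfolding submodule_vec_iff
    proof (intro conjI ballI allI)
      have "A * B *\<^sub>v 0\<^sub>v m = 0\<^sub>v m"
        using A B by (intro eq_vecI) (simp_all del: assoc_mult_mat_vec)
      thus "0\<^sub>v m \<in> ?N" using P unfolding submodule_vec_iff by simp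
    next
      fix x y assume xy: "x \<in> ?N" "y \<in> ?N"
      have "x + y - A * B *\<^sub>v (x + y) = (x - A * B *\<^sub>v x) + (y - A * B *\<^sub>v y)"
        using xy AB by (intro eq_vecI) (auto simp: mult_add_distrib_mat_vec)
      thus "x + y \<in> ?N" using xy P unfolding submodule_vec_iff by simp
    next
      fix c x assume x: "x \<in> ?N"
      have "c \<cdot>\<^sub>v x - A * B *\<^sub>v (c \<cdot>\<^sub>v x) = c \<cdot>\<^sub>v (x - A * B *\<^sub>v x)"
        using x AB by (intro eq_vecI) (auto simp: mult_mat_smult_vec right_diff_distrib)
      thus "c \<cdot>\<^sub>v x \<in> ?N" using x P unfolding submodule_vec_iff by simp
    qed auto
  next
    fix j assume j: "j < m"
    have "B *\<^sub>v unit_vec m j = b j" using j b(1)[OF j] by (intro eq_vecI) (auto simp: B_def)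
    hence "A * B *\<^sub>v unit_vec m j = A *\<^sub>v b j" using A B by simp
    thus "unit_vec m j \<in> ?N" using b(2)[OF j] by simp
  qed
  hence N: "v - A * B *\<^sub>v v \<in> P" if "v \<in> carrier_vec m" for v using that by blast
  have "A * B * A = A"
  proof (rule mat_eq_vecI)
    fix u :: "'a vec" assume u: "u \<in> carrier_vec n"
    let ?x = "A *\<^sub>v u"
    have x: "?x \<in> carrier_vec m" using A u by simp
    have "?x - A * B *\<^sub>v ?x = A *\<^sub>v (u - B *\<^sub>v ?x)"
      using A B u x by (simp add: mult_minus_distrib_mat_vec)
    hence "?x - A * B *\<^sub>v ?x \<in> mat_image A" using A B u x unfolding mat_image_def by auto
    hence z: "?x - A * B *\<^sub>v ?x = 0\<^sub>v m" using N[OF x] int by blast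
    have "A * B *\<^sub>v ?x = ?x"
    proof (rule eq_vecI)
      fix i assume i: "i < dim_vec ?x"
      hence "(?x - A * B *\<^sub>v ?x) $ i = 0" unfolding z using A by simp
      thus "(A * B *\<^sub>v ?x) $ i = ?x $ i" using i A B by simp
    qed (use A B in auto)
    thus "A * B * A *\<^sub>v u = A *\<^sub>v u" using assoc_mult_mat_vec[OF AB A u] by simp
  qed (use A B in auto)
  thus "\<exists>B\<in>carrier_mat n m. A * B * A = A" using B by blast
qed

lemma mat_mult_index_sum:
  fixes A B :: "'a::comm_ring_1 mat"
  assumes "A \<in> carrier_mat m n" "B \<in> carrier_mat n p" "i < m" "j < p"
  shows "(A * B) $$ (i, j) = (\<Sum>k<n. A $$ (i, k) * B $$ (k, j))"
  using assms by (simp add: scalar_prod_def lessThan_atLeast0)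

lemma triple_mat_mult_index:
  fixes A B C :: "'a::comm_ring_1 mat"
  assumes "A \<in> carrier_mat m n" "B \<in> carrier_mat n p" "C \<in> carrier_mat p q" "i < m" "j < q"
  shows "(A * B * C) $$ (i, j) = (\<Sum>l<p. \<Sum>k<n. A $$ (i, k) * C $$ (l, j) * B $$ (k, l))"
proof -
  have "(A * B * C) $$ (i, j) = (\<Sum>l<p. (A * B) $$ (i, l) * C $$ (l, j))"
    by (rule mat_mult_index_sum[OF mult_carrier_mat[OF assms(1,2)] assms(3-5)])
  also have "\<dots> = (\<Sum>l<p. \<Sum>k<n. A $$ (i, k) * C $$ (l, j) * B $$ (k, l))"
    by (intro sum.cong refl)
      (simp add: mat_mult_index_sum[OF assms(1,2,4)] sum_distrib_left mult_ac del: index_mult_mat)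
  finally show ?thesis .
qed

text \<open>
  For descent, the scalars \<open>x\<close> such that \<open>A * B * A = x A\<close> has a solution \<open>B\<close> form an ideal of $\mathbf{A}$. A
  solution of \<open>A * B * A = A\<close> over $\mathbf{A}(t)$ with common denominator \<open>s\<close> puts every coefficient of \<open>s\<close> into
  this ideal, so it contains 1.
\<close>

lemma locally_simple_nagata_iff:
  fixes A :: "'a::comm_ring_1 mat"
  assumes A: "A \<in> carrier_mat m n"
  shows "locally_simple (map_mat nagata_const A) \<longleftrightarrow> locally_simple A"
proof
  interpret nc: comm_ring_hom "nagata_const :: 'a \<Rightarrow> 'a nagata" by (rule comm_ring_hom_nagata_const)
  assume "locally_simple A"
  then obtain B where B: "B \<in> carrier_mat n m" "A * B * A = A" using locally_simple_iff[OF A] by blast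
  let ?A = "map_mat nagata_const A" and ?B = "map_mat nagata_const B"
  have "?A * ?B * ?A = ?A" using A B
    by (metis mult_carrier_mat nc.mat_hom_mult)
  thus "locally_simple ?A" using A B by (subst locally_simple_iff[of _ m n]) auto
next
  let ?A = "map_mat nagata_const A"
  assume "locally_simple ?A"
  then obtain B where B: "B \<in> carrier_mat n m" and ABA: "?A * B * ?A = ?A"
    using A by (subst (asm) locally_simple_iff[of _ m n]) auto
  \<comment> \<open>The entries of \<open>B\<close> are enumerated row by row to share one denominator \<open>s\<close>.\<close>
  obtain s p where s: "primitive_poly s"
    and p: "\<And>k. k < n * m \<Longrightarrow> nagata_poly s * B $$ (k div m, k mod m) = nagata_poly (p k)"
    using common_denominator[of "n * m" "\<lambda>k. B $$ (k div m, k mod m)"] by blast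
  have p': "nagata_poly s * B $$ (k, l) = nagata_poly (p (k * m + l))" if "k < n" "l < m" for k l
  proof -
    have "k * m + l < Suc k * m" using that by simp
    also have "\<dots> \<le> n * m" using that by (intro mult_le_mono1) simp
    finally show ?thesis using p[of "k * m + l"] that by simp
  qed
  let ?J = "{x. \<exists>B\<in>carrier_mat n m. A * B * A = x \<cdot>\<^sub>m A}"
  have "ideal ?J class_ring"
    unfolding ideal_class_ring_iff
  proof (intro conjI ballI allI)
    show "0 \<in> ?J" using A by (auto intro!: bexI[of _ "0\<^sub>m n m"])
  next
    fix x y assume "x \<in> ?J" "y \<in> ?J"
    then obtain B C where B: "B \<in> carrier_mat n m" "A * B * A = x \<cdot>\<^sub>m A"
      and C: "C \<in> carrier_mat n m" "A * C * A = y \<cdot>\<^sub>m A" by blast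
    have "A * (B + C) * A = A * B * A + A * C * A"
      using A B(1) C(1)
      by (simp del: assoc_mult_mat add: mult_add_distrib_mat[OF A] add_mult_distrib_mat[of _ m m])
    also have "\<dots> = (x + y) \<cdot>\<^sub>m A" unfolding B C by (rule add_smult_distrib_right_mat[OF A, symmetric])
    finally show "x + y \<in> ?J"
      using B(1) C(1) by (intro CollectI bexI[of _ "B + C"]) auto
  next
    fix x c assume "x \<in> ?J"
    then obtain B where B: "B \<in> carrier_mat n m" "A * B * A = x \<cdot>\<^sub>m A" by blast
    have "A * (c \<cdot>\<^sub>m B) * A = c \<cdot>\<^sub>m (A * B * A)"
      using A B(1) mult_carrier_mat[OF A B(1)]
      by (simp del: assoc_mult_mat add: mult_smult_distrib[OF A] mult_smult_assoc_mat[of _ m m])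
    also have "\<dots> = (c * x) \<cdot>\<^sub>m A" unfolding B(2) by (intro eq_matI) auto
    finally show "c * x \<in> ?J"
      using B(1) by (intro CollectI bexI[of _ "c \<cdot>\<^sub>m B"]) auto
  qed
  moreover have "coeff s d \<in> ?J" for d
  proof -
    let ?B = "mat n m (\<lambda>(k, l). coeff (p (k * m + l)) d)"
    have "A * ?B * A = coeff s d \<cdot>\<^sub>m A"
    proof (rule eq_matI)
      fix i j assume "i < dim_row (coeff s d \<cdot>\<^sub>m A)" "j < dim_col (coeff s d \<cdot>\<^sub>m A)"
      hence ij: "i < m" "j < n" using A by auto
      have "nagata_poly (Polynomial.smult (A $$ (i, j)) s) = nagata_poly s * ?A $$ (i, j)"
        using ij A by (simp add: nagata_const_poly flip: nagata_poly_mult)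
      also have "\<dots> = nagata_poly s * (?A * B * ?A) $$ (i, j)" by (simp only: ABA)
      also have "\<dots> = (\<Sum>l<m. \<Sum>k<n. ?A $$ (i, k) * ?A $$ (l, j) * (nagata_poly s * B $$ (k, l)))"
        using ij A B by (subst triple_mat_mult_index[of _ m n _ m _ n])
          (auto simp: sum_distrib_left mult_ac)
      also have "\<dots> = (\<Sum>l<m. \<Sum>k<n. nagata_poly (Polynomial.smult (A $$ (i, k) * A $$ (l, j)) (p (k * m + l))))"
        using ij A by (intro sum.cong refl) (simp add: p' nagata_const_poly mult.commute flip: nagata_poly_mult)
      also have "\<dots> = nagata_poly (\<Sum>l<m. \<Sum>k<n. Polynomial.smult (A $$ (i, k) * A $$ (l, j)) (p (k * m + l)))"
        by (simp only: nagata_poly_sum)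
      finally have eq: "Polynomial.smult (A $$ (i, j)) s =
          (\<Sum>l<m. \<Sum>k<n. Polynomial.smult (A $$ (i, k) * A $$ (l, j)) (p (k * m + l)))" by simp
      have "A $$ (i, j) * coeff s d =
          (\<Sum>l<m. \<Sum>k<n. A $$ (i, k) * A $$ (l, j) * coeff (p (k * m + l)) d)"
        using arg_cong[OF eq, of "\<lambda>q. coeff q d"] by (simp add: coeff_sum)
      also have "\<dots> = (A * ?B * A) $$ (i, j)"
        using ij A by (subst triple_mat_mult_index[of _ m n _ m _ n]) auto
      finally show "(A * ?B * A) $$ (i, j) = (coeff s d \<cdot>\<^sub>m A) $$ (i, j)"
        using ij A by (simp add: mult.commute)
    qed (use A in auto)
    thus ?thesis by (auto intro!: bexI[of _ ?B])
  qed
  ultimately have "1 \<in> ?J" using primitive_polyD[OF s, of ?J] by blast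
  moreover have "1 \<cdot>\<^sub>m A = A" by (rule eq_matI) auto
  ultimately show "locally_simple A" using locally_simple_iff[OF A] by auto
qed

section \<open>Diagonal form of regular matrices\<close>

lemma prod_cong_ideal:
  fixes f g :: "'b \<Rightarrow> 'a::comm_ring_1"
  assumes J: "ideal J class_ring" and "\<And>i. i \<in> S \<Longrightarrow> f i - g i \<in> J"
  shows "prod f S - prod g S \<in> J"
  using assms(2)
proof (induction S rule: infinite_finite_induct)
  case (insert i S)
  have "prod f (insert i S) - prod g (insert i S) =
      f i * (prod f S - prod g S) + (f i - g i) * prod g S"
    using insert.hyps by (simp add: algebra_simps)
  also have "\<dots> \<in> J" using insert by (intro ideal_mem[OF J]) auto
  finally show ?case .
qed (use ideal_mem[OF J] in auto)

lemma det_cong_ideal: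
  fixes M N :: "'a::comm_ring_1 mat"
  assumes J: "ideal J class_ring" and M: "M \<in> carrier_mat n n" and N: "N \<in> carrier_mat n n"
    and MN: "\<And>i j. i < n \<Longrightarrow> j < n \<Longrightarrow> M $$ (i, j) - N $$ (i, j) \<in> J"
  shows "det M - det N \<in> J"
proof -
  have "det M - det N = (\<Sum>p | p permutes {0..<n}.
      signof p * ((\<Prod>i = 0..<n. M $$ (i, p i)) - (\<Prod>i = 0..<n. N $$ (i, p i))))"
    using M N by (simp add: det_def sum_subtractf right_diff_distrib)
  also have "\<dots> \<in> J"
  proof (intro ideal_sum_mem[OF J] ideal_mem(3)[OF J] prod_cong_ideal[OF J])
    fix p i assume "p \<in> {p. p permutes {0..<n}}" "i \<in> {0..<n}"
    thus "M $$ (i, p i) - N $$ (i, p i) \<in> J" using MN permutes_in_image[of p "{0..<n}" i] by auto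
  qed
  finally show ?thesis .
qed

text \<open>
  The determinant trick: \<open>1 - C * B\<close> annihilates \<open>C\<close>, hence so does its determinant (multiply by the adjugate),
  and modulo the ideal of the entries of \<open>C\<close> this determinant is 1. So \<open>e = 1 - det (1 - C * B)\<close> lies in that
  ideal and acts as the identity on it. Membership is phrased with an arbitrary ideal containing the entries,
  which is how it is used with extended ideals.
\<close>

lemma regular_entries_idempotent:
  fixes C B :: "'a::comm_ring_1 mat"
  assumes C: "C \<in> carrier_mat m n" and B: "B \<in> carrier_mat n m" and CBC: "C * B * C = C"
  shows "\<exists>e. e * e = e \<and> e \<cdot>\<^sub>m C = C \<and>
    (\<forall>J. ideal J class_ring \<longrightarrow> (\<forall>i<m. \<forall>j<n. C $$ (i, j) \<in> J) \<longrightarrow> e \<in> J)"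
proof -
  let ?M = "1\<^sub>m m - C * B"
  define e where "e = 1 - det ?M"
  have M: "?M \<in> carrier_mat m m" and CB: "C * B \<in> carrier_mat m m" using C B by auto
  have "?M * C = 0\<^sub>m m n"
    using minus_mult_distrib_mat[OF one_carrier_mat CB C] C CBC by simp
  hence "adj_mat ?M * ?M * C = 0\<^sub>m m n" using adj_mat(1)[OF M] M C by simp
  hence "det ?M \<cdot>\<^sub>m 1\<^sub>m m * C = 0\<^sub>m m n" using adj_mat(3)[OF M] by simp
  hence z: "det ?M \<cdot>\<^sub>m C = 0\<^sub>m m n" using C by (simp add: mult_smult_assoc_mat[of _ m m _ n])
  have eC: "e * C $$ (i, j) = C $$ (i, j)" if "i < m" "j < n" for i j
  proof -
    have "(det ?M \<cdot>\<^sub>m C) $$ (i, j) = 0" unfolding z using that by simp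
    thus ?thesis using that C by (simp add: e_def left_diff_distrib)
  qed
  have mem: "e \<in> J" if J: "ideal J class_ring" and CJ: "\<forall>i<m. \<forall>j<n. C $$ (i, j) \<in> J" for J
  proof -
    have "det (1\<^sub>m m) - det ?M \<in> J"
    proof (rule det_cong_ideal[OF J _ M])
      fix i j assume ij: "i < m" "j < m"
      have "(C * B) $$ (i, j) = (\<Sum>k = 0..<n. C $$ (i, k) * B $$ (k, j))"
        using ij B C by (simp add: scalar_prod_def)
      also have "\<dots> \<in> J" using CJ ij by (intro ideal_sum_mem[OF J] ideal_mem(4)[OF J]) auto
      finally show "1\<^sub>m m $$ (i, j) - ?M $$ (i, j) \<in> J" using ij B C by simp
    qed simp
    thus ?thesis by (simp add: e_def)
  qed
  have "ideal {x. e * x = x} class_ring"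
    unfolding ideal_class_ring_iff by (auto simp: distrib_left mult.left_commute)
  hence "e * e = e" using mem[of "{x. e * x = x}"] eC by blast
  moreover have "e \<cdot>\<^sub>m C = C" using C eC by (intro eq_matI) auto
  ultimately show ?thesis using mem by blast
qed

text \<open>
  The family consists of the entries of \<open>C\<close>, row by row, followed by \<open>1 - e\<close>. An extended ideal containing all
  of them contains \<open>e\<close> as well, hence 1, so \<open>spread_unit\<close> applies; multiplying by \<open>e\<close> removes the last summand.
  With \<open>\<tau> = t^N\<close> and \<open>\<rho> = \<tau>^n\<close> the remaining sum is bilinear in the vectors \<open>(1, \<rho>, \<rho>\<^sup>2, \<dots>)\<close> and \<open>(1, \<tau>, \<tau>\<^sup>2, \<dots>)\<close>,
  whose first coordinate 1 makes them extendable to invertible matrices.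
\<close>

lemma exists_pivot_form:
  fixes C :: "'a::comm_ring_1 nagata mat"
  assumes C: "C \<in> carrier_mat m n" and e: "e * e = e" "e \<cdot>\<^sub>m C = C"
    and mem: "\<And>J. ideal J class_ring \<Longrightarrow> (\<And>i j. i < m \<Longrightarrow> j < n \<Longrightarrow> C $$ (i, j) \<in> J) \<Longrightarrow> e \<in> J"
  shows "\<exists>u w \<rho> \<tau>. u * w = 1 \<and> u * (\<Sum>i<m. \<Sum>j<n. \<rho> ^ i * \<tau> ^ j * C $$ (i, j)) = e"
proof -
  have eC: "e * C $$ (i, j) = C $$ (i, j)" if "i < m" "j < n" for i j
    using that C arg_cong[OF e(2), of "\<lambda>M. M $$ (i, j)"] by simp
  define c where "c k = (if k < m * n then C $$ (k div n, k mod n) else 1 - e)" for k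
  have idx: "i * n + j < m * n" if "i < m" "j < n" for i j
  proof -
    have "i * n + j < Suc i * n" using that by simp
    also have "\<dots> \<le> m * n" using that by (intro mult_le_mono1) simp
    finally show ?thesis .
  qed
  have c: "c (i * n + j) = C $$ (i, j)" if "i < m" "j < n" for i j
    using idx[OF that] that by (simp add: c_def)
  have "\<exists>N u. u * (\<Sum>k<Suc (m * n). nagata_t ^ (N * k) * c k) = 1"
  proof (rule spread_unit)
    fix I :: "'a set"
    assume I: "ideal I class_ring" and cI: "\<And>k. k < Suc (m * n) \<Longrightarrow> c k \<in> ext_ideal I"
    note X = ext_ideal_ideal[OF I]
    have "e \<in> ext_ideal I"
    proof (rule mem[OF X])
      fix i j assume ij: "i < m" "j < n"
      show "C $$ (i, j) \<in> ext_ideal I"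
        unfolding c[OF ij, symmetric] using idx[OF ij] by (intro cI) simp
    qed
    moreover have "1 - e \<in> ext_ideal I" using cI[of "m * n"] by (simp add: c_def)
    ultimately have "e + (1 - e) \<in> ext_ideal I" by (rule ideal_mem(2)[OF X])
    thus "1 \<in> I" using one_in_ext_ideal[OF I] by simp
  qed
  then obtain N u where u: "u * (\<Sum>k<Suc (m * n). nagata_t ^ (N * k) * c k) = 1" by blast
  let ?\<tau> = "nagata_t ^ N :: 'a nagata" and ?w = "\<Sum>k<Suc (m * n). nagata_t ^ (N * k) * c k"
  have "u * (\<Sum>i<m. \<Sum>j<n. (?\<tau> ^ n) ^ i * ?\<tau> ^ j * C $$ (i, j)) =
      u * (\<Sum>i<m. \<Sum>j<n. ?\<tau> ^ (i * n + j) * c (i * n + j))"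
    by (simp add: c[symmetric] power_add power_mult mult.commute[of _ n])
  also have "(\<Sum>i<m. \<Sum>j<n. ?\<tau> ^ (i * n + j) * c (i * n + j)) = (\<Sum>k<m * n. ?\<tau> ^ k * c k)"
    by (subst sum.nat_group[symmetric])
      (simp add: sum.atLeastLessThan_shift_0[of _ "_ * n"] lessThan_atLeast0)
  also have "\<dots> = (\<Sum>k<m * n. nagata_t ^ (N * k) * c k)" by (simp add: power_mult)
  also have "\<dots> = e * ?w"
  proof -
    have "e * c k = c k" if "k < m * n" for k
    proof -
      have "n > 0" using that by (cases n) auto
      hence "k div n < m" "k mod n < n" using that by (auto simp: less_mult_imp_div_less)
      thus ?thesis using that by (simp add: c_def eC)
    qed
    hence "(\<Sum>k<m * n. nagata_t ^ (N * k) * c k) = e * (\<Sum>k<m * n. nagata_t ^ (N * k) * c k)"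
      by (simp add: sum_distrib_left mult.left_commute[of e])
    moreover have "e * c (m * n) = 0" using e(1) by (simp add: c_def right_diff_distrib)
    moreover have "e * ?w = e * (\<Sum>k<m * n. nagata_t ^ (N * k) * c k) + nagata_t ^ (N * (m * n)) * (e * c (m * n))"
      by (simp only: sum.lessThan_Suc distrib_left mult.left_commute[of e])
    ultimately show ?thesis by (simp only: mult_zero_right add_0_right)
  qed
  also have "u * (e * ?w) = e" unfolding mult.left_commute[of u] u by simp
  finally show ?thesis using u by blast
qed

definition mat_equiv :: "nat \<Rightarrow> nat \<Rightarrow> 'a::comm_ring_1 mat \<Rightarrow> 'a mat \<Rightarrow> bool" where
  "mat_equiv m n C D \<longleftrightarrow> C \<in> carrier_mat m n \<and> (\<exists>P P' Q Q'.
     P \<in> carrier_mat m m \<and> P' \<in> carrier_mat m m \<and> Q \<in> carrier_mat n n \<and> Q' \<in> carrier_mat n n \<and>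
     P * P' = 1\<^sub>m m \<and> P' * P = 1\<^sub>m m \<and> Q * Q' = 1\<^sub>m n \<and> Q' * Q = 1\<^sub>m n \<and> P * C * Q = D)"

lemma mat_equivE:
  assumes "mat_equiv m n C D"
  obtains P P' Q Q' where "C \<in> carrier_mat m n" "P \<in> carrier_mat m m" "P' \<in> carrier_mat m m"
    "Q \<in> carrier_mat n n" "Q' \<in> carrier_mat n n"
    "P * P' = 1\<^sub>m m" "P' * P = 1\<^sub>m m" "Q * Q' = 1\<^sub>m n" "Q' * Q = 1\<^sub>m n" "P * C * Q = D"
  using assms unfolding mat_equiv_def by blast

lemma mat_equivI:
  assumes "C \<in> carrier_mat m n" "P \<in> carrier_mat m m" "P' \<in> carrier_mat m m"
    "Q \<in> carrier_mat n n" "Q' \<in> carrier_mat n n"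
    "P * P' = 1\<^sub>m m" "P' * P = 1\<^sub>m m" "Q * Q' = 1\<^sub>m n" "Q' * Q = 1\<^sub>m n" "P * C * Q = D"
  shows "mat_equiv m n C D"
  using assms unfolding mat_equiv_def by blast

text \<open>
  Associativity conditional on dimensions only, so that rewriting can re-bracket long products.
\<close>

lemma mult_mat_assoc:
  fixes A B C :: "'a::comm_ring_1 mat"
  assumes "dim_col A = dim_row B" "dim_col B = dim_row C"
  shows "A * B * C = A * (B * C)"
  using assms by (intro assoc_mult_mat[of A "dim_row A" "dim_row B" B "dim_row C" C "dim_col C"]) auto

lemma inverse_mult_cancel:
  fixes P P' X :: "'a::comm_ring_1 mat"
  assumes "P * P' = 1\<^sub>m m" "dim_col P = dim_row P'" "dim_col P' = dim_row X" "dim_row X = m"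
  shows "P * (P' * X) = X"
proof -
  have "P * (P' * X) = 1\<^sub>m m * X" using assms mult_mat_assoc[of P P' X] by simp
  also have "\<dots> = X" using assms(4) by (intro left_mult_one_mat[of X m "dim_col X"]) auto
  finally show ?thesis .
qed

lemma mat_equiv_refl:
  assumes "C \<in> carrier_mat m n"
  shows "mat_equiv m n C C"
  by (rule mat_equivI[of _ _ _ "1\<^sub>m m" "1\<^sub>m m" "1\<^sub>m n" "1\<^sub>m n"]) (use assms in auto)

lemma mat_equiv_trans:
  assumes "mat_equiv m n C D" "mat_equiv m n D E"
  shows "mat_equiv m n C E"
proof -
  from assms(1) obtain P P' Q Q' where 1: "C \<in> carrier_mat m n" "P \<in> carrier_mat m m" "P' \<in> carrier_mat m m"
    "Q \<in> carrier_mat n n" "Q' \<in> carrier_mat n n"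
    "P * P' = 1\<^sub>m m" "P' * P = 1\<^sub>m m" "Q * Q' = 1\<^sub>m n" "Q' * Q = 1\<^sub>m n" "P * C * Q = D"
    by (rule mat_equivE)
  from assms(2) obtain R R' S S' where 2: "R \<in> carrier_mat m m" "R' \<in> carrier_mat m m"
    "S \<in> carrier_mat n n" "S' \<in> carrier_mat n n"
    "R * R' = 1\<^sub>m m" "R' * R = 1\<^sub>m m" "S * S' = 1\<^sub>m n" "S' * S = 1\<^sub>m n" "R * D * S = E"
    by (rule mat_equivE)
  note dims = 1(1-5)[unfolded carrier_mat_def] 2(1-4)[unfolded carrier_mat_def]
  show ?thesis
  proof (rule mat_equivI[of _ _ _ "R * P" "P' * R'" "Q * S" "S' * Q'"])
    show "R * P * (P' * R') = 1\<^sub>m m" "P' * R' * (R * P) = 1\<^sub>m m"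
      using dims by (simp_all add: mult_mat_assoc inverse_mult_cancel[OF 1(6)]
          inverse_mult_cancel[OF 2(6)] 1 2 del: assoc_mult_mat)
    show "Q * S * (S' * Q') = 1\<^sub>m n" "S' * Q' * (Q * S) = 1\<^sub>m n"
      using dims by (simp_all add: mult_mat_assoc inverse_mult_cancel[OF 1(9)]
          inverse_mult_cancel[OF 2(7)] 1 2 del: assoc_mult_mat)
    show "R * P * C * (Q * S) = E"
      unfolding 2(9)[symmetric] 1(10)[symmetric]
      using dims by (simp add: mult_mat_assoc del: assoc_mult_mat)
  qed (use 1(1-5) 2(1-4) in auto)
qed

lemma mat_equiv_sym:
  assumes "mat_equiv m n C D"
  shows "mat_equiv m n D C"
proof -
  from assms obtain P P' Q Q' where 1: "C \<in> carrier_mat m n" "P \<in> carrier_mat m m" "P' \<in> carrier_mat m m"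
    "Q \<in> carrier_mat n n" "Q' \<in> carrier_mat n n"
    "P * P' = 1\<^sub>m m" "P' * P = 1\<^sub>m m" "Q * Q' = 1\<^sub>m n" "Q' * Q = 1\<^sub>m n" "P * C * Q = D"
    by (rule mat_equivE)
  show ?thesis
  proof (rule mat_equivI[of _ _ _ P' P Q' Q])
    show "P' * D * Q' = C" unfolding 1(10)[symmetric]
      using 1(1-5)[unfolded carrier_mat_def]
      by (simp add: mult_mat_assoc inverse_mult_cancel[OF 1(7)] 1(8) del: assoc_mult_mat)
    show "D \<in> carrier_mat m n"
      unfolding 1(10)[symmetric] using 1(1-5) by (intro mult_carrier_mat)
  qed (rule 1)+
qed

lemma mat_equiv_regular:
  fixes C D :: "'a::comm_ring_1 mat"
  assumes "mat_equiv m n C D" and B: "B \<in> carrier_mat n m" "C * B * C = C"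
  shows "\<exists>X\<in>carrier_mat n m. D * X * D = D"
proof -
  from assms(1) obtain P P' Q Q' where 1: "C \<in> carrier_mat m n" "P \<in> carrier_mat m m" "P' \<in> carrier_mat m m"
    "Q \<in> carrier_mat n n" "Q' \<in> carrier_mat n n"
    "P * P' = 1\<^sub>m m" "P' * P = 1\<^sub>m m" "Q * Q' = 1\<^sub>m n" "Q' * Q = 1\<^sub>m n" "P * C * Q = D"
    by (rule mat_equivE)
  have D: "D \<in> carrier_mat m n" unfolding 1(10)[symmetric] using 1(1-5) by (intro mult_carrier_mat)
  have X: "Q' * B * P' \<in> carrier_mat n m" using 1(1-5) B(1) by (intro mult_carrier_mat)
  note dims = 1(1-5)[unfolded carrier_mat_def] B(1)[unfolded carrier_mat_def]
  have "D * (Q' * B * P') * D = P * (C * B * C) * Q"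
    unfolding 1(10)[symmetric] using dims
    by (simp add: mult_mat_assoc inverse_mult_cancel[OF 1(7)] inverse_mult_cancel[OF 1(8)]
        del: assoc_mult_mat)
  also have "\<dots> = D" unfolding B(2) 1(10) ..
  finally show ?thesis using X by blast
qed

lemma unit_first_row_inverse:
  fixes X :: "'a::comm_ring_1 mat"
  assumes X: "X \<in> carrier_mat 1 m" and a: "a * b = 1"
  shows "four_block_mat (a \<cdot>\<^sub>m 1\<^sub>m 1) X (0\<^sub>m m 1) (1\<^sub>m m) *
    four_block_mat (b \<cdot>\<^sub>m 1\<^sub>m 1) (- b \<cdot>\<^sub>m X) (0\<^sub>m m 1) (1\<^sub>m m) = 1\<^sub>m (Suc m)"
proof -
  have "four_block_mat (a \<cdot>\<^sub>m 1\<^sub>m 1) X (0\<^sub>m m 1) (1\<^sub>m m) *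
    four_block_mat (b \<cdot>\<^sub>m 1\<^sub>m 1) (- b \<cdot>\<^sub>m X) (0\<^sub>m m 1) (1\<^sub>m m) =
    four_block_mat (a \<cdot>\<^sub>m 1\<^sub>m 1 * (b \<cdot>\<^sub>m 1\<^sub>m 1) + X * 0\<^sub>m m 1)
      (a \<cdot>\<^sub>m 1\<^sub>m 1 * (- b \<cdot>\<^sub>m X) + X * 1\<^sub>m m)
      (0\<^sub>m m 1 * (b \<cdot>\<^sub>m 1\<^sub>m 1) + 1\<^sub>m m * 0\<^sub>m m 1) (0\<^sub>m m 1 * (- b \<cdot>\<^sub>m X) + 1\<^sub>m m * 1\<^sub>m m)"
    using X by (intro mult_four_block_mat[of _ 1 1 _ m _ m _ _ 1 _ m]) auto
  also have "a \<cdot>\<^sub>m 1\<^sub>m 1 * (b \<cdot>\<^sub>m 1\<^sub>m 1) + X * 0\<^sub>m m 1 = 1\<^sub>m 1"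
    using X a by (intro eq_matI) (auto simp: scalar_prod_def)
  also have "a \<cdot>\<^sub>m 1\<^sub>m 1 * (- b \<cdot>\<^sub>m X) + X * 1\<^sub>m m = 0\<^sub>m 1 m"
    using X a by (intro eq_matI) (auto simp: scalar_prod_def simp flip: mult.assoc)
  also have "0\<^sub>m m 1 * (b \<cdot>\<^sub>m 1\<^sub>m 1) + 1\<^sub>m m * 0\<^sub>m m 1 = 0\<^sub>m m 1" by (intro eq_matI) auto
  also have "0\<^sub>m m 1 * (- b \<cdot>\<^sub>m X) + 1\<^sub>m m * 1\<^sub>m m = 1\<^sub>m m"
    using X by (intro eq_matI) auto
  finally show ?thesis by simp
qed

lemma unit_first_row_invertible:
  fixes X :: "'a::comm_ring_1 mat"
  assumes X: "X \<in> carrier_mat 1 m" and a: "a * b = 1"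
  defines "P \<equiv> four_block_mat (a \<cdot>\<^sub>m 1\<^sub>m 1) X (0\<^sub>m m 1) (1\<^sub>m m)"
  shows "\<exists>P'\<in>carrier_mat (Suc m) (Suc m). P * P' = 1\<^sub>m (Suc m) \<and> P' * P = 1\<^sub>m (Suc m)"
proof -
  have "- a \<cdot>\<^sub>m (- b \<cdot>\<^sub>m X) = X"
    using a by (intro eq_matI) (auto simp flip: mult.assoc)
  hence "four_block_mat (b \<cdot>\<^sub>m 1\<^sub>m 1) (- b \<cdot>\<^sub>m X) (0\<^sub>m m 1) (1\<^sub>m m) * P = 1\<^sub>m (Suc m)"
    using unit_first_row_inverse[of "- b \<cdot>\<^sub>m X" m b a] X a unfolding P_def by (simp add: mult.commute)
  moreover have "four_block_mat (b \<cdot>\<^sub>m 1\<^sub>m 1) (- b \<cdot>\<^sub>m X) (0\<^sub>m m 1) (1\<^sub>m m) \<in> carrier_mat (Suc m) (Suc m)"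
    using X by auto
  ultimately show ?thesis using unit_first_row_inverse[OF X a] unfolding P_def by blast
qed

lemma unit_first_col_invertible:
  fixes Y :: "'a::comm_ring_1 mat"
  assumes Y: "Y \<in> carrier_mat n 1"
  defines "Q \<equiv> four_block_mat (1\<^sub>m 1) (0\<^sub>m 1 n) Y (1\<^sub>m n)"
  shows "\<exists>Q'\<in>carrier_mat (Suc n) (Suc n). Q * Q' = 1\<^sub>m (Suc n) \<and> Q' * Q = 1\<^sub>m (Suc n)"
proof -
  let ?P = "four_block_mat (1 \<cdot>\<^sub>m 1\<^sub>m 1) (transpose_mat Y) (0\<^sub>m n 1) (1\<^sub>m n)"
  have T: "transpose_mat Y \<in> carrier_mat 1 n" using Y by simp
  have P: "?P \<in> carrier_mat (Suc n) (Suc n)" by auto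
  obtain P' where P': "P' \<in> carrier_mat (Suc n) (Suc n)" "?P * P' = 1\<^sub>m (Suc n)" "P' * ?P = 1\<^sub>m (Suc n)"
    using unit_first_row_invertible[OF T, of 1 1] by auto
  have Q: "transpose_mat ?P = Q"
    unfolding Q_def using Y by (intro eq_matI) auto
  have "Q * transpose_mat P' = 1\<^sub>m (Suc n)" "transpose_mat P' * Q = 1\<^sub>m (Suc n)"
    unfolding Q[symmetric] transpose_mult[OF P'(1) P, symmetric] transpose_mult[OF P P'(1), symmetric]
    by (simp_all only: P'(2,3) transpose_one)
  thus ?thesis using P'(1) by (auto intro!: bexI[of _ "transpose_mat P'"])
qed

text \<open>
  The two invertible outer factors are chosen so that the corner entry is the bilinear expression
  of \<open>exists_pivot_form\<close>: the first row on the left is \<open>u (1, \<rho>, \<rho>\<^sup>2, \<dots>)\<close>, the first column on the right is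
  \<open>(1, \<tau>, \<tau>\<^sup>2, \<dots>)\<close>.
\<close>

lemma pivot_entry:
  fixes C :: "'a::comm_ring_1 mat"
  assumes C: "C \<in> carrier_mat (Suc m) (Suc n)"
  shows "(four_block_mat (u \<cdot>\<^sub>m 1\<^sub>m 1) (mat 1 m (\<lambda>(_, j). u * \<rho> ^ Suc j)) (0\<^sub>m m 1) (1\<^sub>m m) * C *
      four_block_mat (1\<^sub>m 1) (0\<^sub>m 1 n) (mat n 1 (\<lambda>(i, _). \<tau> ^ Suc i)) (1\<^sub>m n)) $$ (0, 0) =
    u * (\<Sum>i<Suc m. \<Sum>j<Suc n. \<rho> ^ i * \<tau> ^ j * C $$ (i, j))" (is "(?P * C * ?Q) $$ _ = _")
proof -
  have P: "?P \<in> carrier_mat (Suc m) (Suc m)" and Q: "?Q \<in> carrier_mat (Suc n) (Suc n)" by auto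
  have "(?P * C * ?Q) $$ (0, 0) =
      (\<Sum>l<Suc n. \<Sum>k<Suc m. ?P $$ (0, k) * ?Q $$ (l, 0) * C $$ (k, l))"
    by (rule triple_mat_mult_index[OF P C Q]) auto
  also have "\<dots> = (\<Sum>l<Suc n. \<Sum>k<Suc m. u * (\<rho> ^ k * \<tau> ^ l * C $$ (k, l)))"
  proof (intro sum.cong refl)
    fix l k assume lk: "l \<in> {..<Suc n}" "k \<in> {..<Suc m}"
    have "?P $$ (0, k) = u * \<rho> ^ k" using lk by (cases k) auto
    moreover have "?Q $$ (l, 0) = \<tau> ^ l" using lk by (cases l) auto
    ultimately show "?P $$ (0, k) * ?Q $$ (l, 0) * C $$ (k, l) = u * (\<rho> ^ k * \<tau> ^ l * C $$ (k, l))"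
      by (simp add: mult_ac)
  qed
  also have "\<dots> = u * (\<Sum>i<Suc m. \<Sum>j<Suc n. \<rho> ^ i * \<tau> ^ j * C $$ (i, j))"
    unfolding sum_distrib_left[symmetric] by (subst sum.swap) rule
  finally show ?thesis .
qed

text \<open>
  Since \<open>e\<close> fixes every entry, the entries of the first row and column are multiples of the corner entry \<open>e\<close>, with
  themselves as quotients. So the usual elimination works although \<open>e\<close> need not be invertible.
\<close>

lemma clear_row_col:
  fixes C :: "'a::comm_ring_1 mat"
  assumes C: "C \<in> carrier_mat (Suc m) (Suc n)" and e: "e \<cdot>\<^sub>m C = C" and C0: "C $$ (0, 0) = e"
  shows "\<exists>Z\<in>carrier_mat m n. e \<cdot>\<^sub>m Z = Z \<and>
    mat_equiv (Suc m) (Suc n) C (four_block_mat (e \<cdot>\<^sub>m 1\<^sub>m 1) (0\<^sub>m 1 n) (0\<^sub>m m 1) Z)"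
proof -
  have eC: "e * C $$ (i, j) = C $$ (i, j)" if "i < Suc m" "j < Suc n" for i j
    using that C arg_cong[OF e, of "\<lambda>M. M $$ (i, j)"] by simp
  have Ce: "C $$ (i, j) * e = C $$ (i, j)" if "i < Suc m" "j < Suc n" for i j
    using eC[OF that] by (simp only: mult.commute)
  let ?x = "mat 1 n (\<lambda>(_, j). - C $$ (0, Suc j))" and ?y = "mat m 1 (\<lambda>(i, _). - C $$ (Suc i, 0))"
  let ?P = "four_block_mat (1\<^sub>m 1) (0\<^sub>m 1 m) ?y (1\<^sub>m m)"
  let ?Q = "four_block_mat (1 \<cdot>\<^sub>m 1\<^sub>m 1) ?x (0\<^sub>m n 1) (1\<^sub>m n)"
  define Z where "Z = mat m n (\<lambda>(i, j). C $$ (Suc i, Suc j) - C $$ (Suc i, 0) * C $$ (0, Suc j))"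
  have P: "?P \<in> carrier_mat (Suc m) (Suc m)" and Q: "?Q \<in> carrier_mat (Suc n) (Suc n)" by auto
  obtain P' where P': "P' \<in> carrier_mat (Suc m) (Suc m)" "?P * P' = 1\<^sub>m (Suc m)" "P' * ?P = 1\<^sub>m (Suc m)"
    using unit_first_col_invertible[of ?y m] by auto
  obtain Q' where Q': "Q' \<in> carrier_mat (Suc n) (Suc n)" "?Q * Q' = 1\<^sub>m (Suc n)" "Q' * ?Q = 1\<^sub>m (Suc n)"
    using unit_first_row_invertible[of ?x n 1 1] by auto
  have Psum: "(\<Sum>k<Suc m. ?P $$ (i, k) * f k) = (if i = 0 then f 0 else f i - C $$ (i, 0) * f 0)"
    if i: "i < Suc m" for i f
  proof (cases i)
    case 0
    have "(\<Sum>k<Suc m. ?P $$ (i, k) * f k) = (\<Sum>k<Suc m. if k = 0 then f 0 else 0)"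
      using 0 by (intro sum.cong) auto
    thus ?thesis using 0 by (simp del: sum.lessThan_Suc)
  next
    case (Suc i')
    have "(\<Sum>k<Suc m. ?P $$ (i, k) * f k) =
        (\<Sum>k<Suc m. (if k = 0 then - C $$ (i, 0) * f 0 else 0) + (if k = i then f i else 0))"
      using Suc i by (intro sum.cong) auto
    thus ?thesis using Suc i by (simp del: sum.lessThan_Suc add: sum.distrib)
  qed
  have Qsum: "(\<Sum>l<Suc n. ?Q $$ (l, j) * f l) = (if j = 0 then f 0 else f j - C $$ (0, j) * f 0)"
    if j: "j < Suc n" for j f
  proof (cases j)
    case 0
    have "(\<Sum>k<Suc n. ?Q $$ (k, j) * f k) = (\<Sum>k<Suc n. if k = 0 then f 0 else 0)"
      using 0 by (intro sum.cong) auto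
    thus ?thesis using 0 by (simp del: sum.lessThan_Suc)
  next
    case (Suc j')
    have "(\<Sum>k<Suc n. ?Q $$ (k, j) * f k) =
        (\<Sum>k<Suc n. (if k = 0 then - C $$ (0, j) * f 0 else 0) + (if k = j then f j else 0))"
      using Suc j by (intro sum.cong) auto
    thus ?thesis using Suc j by (simp del: sum.lessThan_Suc add: sum.distrib)
  qed
  have "?P * C * ?Q = four_block_mat (e \<cdot>\<^sub>m 1\<^sub>m 1) (0\<^sub>m 1 n) (0\<^sub>m m 1) Z" (is "_ = ?D")
  proof (rule eq_matI)
    fix i j assume "i < dim_row ?D" "j < dim_col ?D"
    hence ij: "i < Suc m" "j < Suc n" by (auto simp: Z_def)
    have "(?P * C * ?Q) $$ (i, j) =
        (\<Sum>l<Suc n. \<Sum>k<Suc m. ?P $$ (i, k) * ?Q $$ (l, j) * C $$ (k, l))"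
      by (rule triple_mat_mult_index[OF P C Q ij])
    also have "\<dots> = (\<Sum>l<Suc n. ?Q $$ (l, j) * (\<Sum>k<Suc m. ?P $$ (i, k) * C $$ (k, l)))"
      unfolding sum_distrib_left by (intro sum.cong refl) (simp only: mult_ac)
    also have "\<dots> = ?D $$ (i, j)"
      unfolding Qsum[OF ij(2)] Psum[OF ij(1)]
      using ij C0 Ce by (cases i; cases j) (auto simp: Z_def)
    finally show "(?P * C * ?Q) $$ (i, j) = ?D $$ (i, j)" .
  qed (auto simp: Z_def)
  hence "mat_equiv (Suc m) (Suc n) C ?D"
    using mat_equivI[OF C P P'(1) Q Q'(1) P'(2,3) Q'(2,3)] by blast
  moreover have "e \<cdot>\<^sub>m Z = Z"
    by (intro eq_matI) (auto simp: Z_def right_diff_distrib eC simp flip: mult.assoc)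
  moreover have "Z \<in> carrier_mat m n" by (simp add: Z_def)
  ultimately show ?thesis by blast
qed

lemma smult_mat_equiv_fixed:
  assumes "mat_equiv m n C D" "e \<cdot>\<^sub>m C = C"
  shows "e \<cdot>\<^sub>m D = D"
proof -
  from assms(1) obtain P P' Q Q' where 1: "C \<in> carrier_mat m n" "P \<in> carrier_mat m m" "P' \<in> carrier_mat m m"
    "Q \<in> carrier_mat n n" "Q' \<in> carrier_mat n n"
    "P * P' = 1\<^sub>m m" "P' * P = 1\<^sub>m m" "Q * Q' = 1\<^sub>m n" "Q' * Q = 1\<^sub>m n" "P * C * Q = D"
    by (rule mat_equivE)
  have PC: "P * C \<in> carrier_mat m n" using 1 by simp
  have "e \<cdot>\<^sub>m (P * C * Q) = P * (e \<cdot>\<^sub>m C) * Q"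
    by (simp only: mult_smult_assoc_mat[OF PC 1(4)] mult_smult_distrib[OF 1(2,1)])
  thus ?thesis unfolding assms(2) 1(10) .
qed

lemma mat_equiv_block:
  fixes Z :: "'a::comm_ring_1 mat"
  assumes "mat_equiv m n Z D"
  shows "mat_equiv (Suc m) (Suc n) (four_block_mat (e \<cdot>\<^sub>m 1\<^sub>m 1) (0\<^sub>m 1 n) (0\<^sub>m m 1) Z)
    (four_block_mat (e \<cdot>\<^sub>m 1\<^sub>m 1) (0\<^sub>m 1 n) (0\<^sub>m m 1) D)"
proof -
  let ?b = "\<lambda>a r s X. four_block_mat (a \<cdot>\<^sub>m 1\<^sub>m 1) (0\<^sub>m 1 s) (0\<^sub>m r 1) X :: 'a mat"
  have mult: "?b a r s X * ?b b s t Y = ?b (a * b) r t (X * Y)"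
    if "X \<in> carrier_mat r s" "Y \<in> carrier_mat s t" for a b r s t and X Y :: "'a mat"
  proof -
    have "?b a r s X * ?b b s t Y = four_block_mat (a \<cdot>\<^sub>m 1\<^sub>m 1 * (b \<cdot>\<^sub>m 1\<^sub>m 1) + 0\<^sub>m 1 s * 0\<^sub>m s 1)
        (a \<cdot>\<^sub>m 1\<^sub>m 1 * 0\<^sub>m 1 t + 0\<^sub>m 1 s * Y) (0\<^sub>m r 1 * (b \<cdot>\<^sub>m 1\<^sub>m 1) + X * 0\<^sub>m s 1)
        (0\<^sub>m r 1 * 0\<^sub>m 1 t + X * Y)"
      using that by (intro mult_four_block_mat[of _ 1 1 _ s _ r _ _ 1 _ t]) auto
    also have "a \<cdot>\<^sub>m 1\<^sub>m 1 * (b \<cdot>\<^sub>m 1\<^sub>m 1) + 0\<^sub>m 1 s * 0\<^sub>m s 1 = (a * b) \<cdot>\<^sub>m 1\<^sub>m 1"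
      by (intro eq_matI) (auto simp: scalar_prod_def)
    also have "a \<cdot>\<^sub>m 1\<^sub>m 1 * 0\<^sub>m 1 t + 0\<^sub>m 1 s * Y = 0\<^sub>m 1 t" using that by (intro eq_matI) auto
    also have "0\<^sub>m r 1 * (b \<cdot>\<^sub>m 1\<^sub>m 1) + X * 0\<^sub>m s 1 = 0\<^sub>m r 1" using that by (intro eq_matI) auto
    also have "0\<^sub>m r 1 * 0\<^sub>m 1 t + X * Y = X * Y" using that by (intro eq_matI) auto
    finally show ?thesis .
  qed
  have one: "?b 1 r r (1\<^sub>m r) = 1\<^sub>m (Suc r)" for r by (intro eq_matI) auto
  from assms(1) obtain P P' Q Q' where 1: "Z \<in> carrier_mat m n" "P \<in> carrier_mat m m" "P' \<in> carrier_mat m m"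
    "Q \<in> carrier_mat n n" "Q' \<in> carrier_mat n n"
    "P * P' = 1\<^sub>m m" "P' * P = 1\<^sub>m m" "Q * Q' = 1\<^sub>m n" "Q' * Q = 1\<^sub>m n" "P * Z * Q = D"
    by (rule mat_equivE)
  have PZ: "P * Z \<in> carrier_mat m n" using 1 by simp
  show ?thesis
  proof (rule mat_equivI[of _ _ _ "?b 1 m m P" "?b 1 m m P'" "?b 1 n n Q" "?b 1 n n Q'"])
    show "?b 1 m m P * ?b e m n Z * ?b 1 n n Q = ?b e m n D"
      unfolding mult[OF 1(2,1)] mult[OF PZ 1(4)] 1(10) by simp
    show "?b 1 m m P * ?b 1 m m P' = 1\<^sub>m (Suc m)" "?b 1 m m P' * ?b 1 m m P = 1\<^sub>m (Suc m)"
      "?b 1 n n Q * ?b 1 n n Q' = 1\<^sub>m (Suc n)" "?b 1 n n Q' * ?b 1 n n Q = 1\<^sub>m (Suc n)"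
      unfolding mult[OF 1(2,3)] mult[OF 1(3,2)] mult[OF 1(4,5)] mult[OF 1(5,4)] 1(6-9)
      by (simp_all only: one mult_1)
  qed (use 1(1-5) in auto)
qed

lemma regular_equiv_pivot_block:
  fixes C B :: "'a::comm_ring_1 nagata mat"
  assumes C: "C \<in> carrier_mat (Suc m) (Suc n)" and B: "B \<in> carrier_mat (Suc n) (Suc m)"
    and CBC: "C * B * C = C"
  shows "\<exists>e Z. e * e = e \<and> Z \<in> carrier_mat m n \<and> e \<cdot>\<^sub>m Z = Z \<and>
    mat_equiv (Suc m) (Suc n) C (four_block_mat (e \<cdot>\<^sub>m 1\<^sub>m 1) (0\<^sub>m 1 n) (0\<^sub>m m 1) Z)"
proof -
  obtain e where e: "e * e = e" "e \<cdot>\<^sub>m C = C"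
    and mem: "\<And>J. ideal J class_ring \<Longrightarrow> (\<forall>i<Suc m. \<forall>j<Suc n. C $$ (i, j) \<in> J) \<Longrightarrow> e \<in> J"
    using regular_entries_idempotent[OF C B CBC] by blast
  have "\<exists>u w \<rho> \<tau>. u * w = 1 \<and> u * (\<Sum>i<Suc m. \<Sum>j<Suc n. \<rho> ^ i * \<tau> ^ j * C $$ (i, j)) = e"
  proof (rule exists_pivot_form[OF C e])
    fix J assume "ideal J class_ring" "\<And>i j. i < Suc m \<Longrightarrow> j < Suc n \<Longrightarrow> C $$ (i, j) \<in> J"
    thus "e \<in> J" by (intro mem allI impI)
  qed
  then obtain u w \<rho> \<tau> where u: "u * w = 1"
    and sum: "u * (\<Sum>i<Suc m. \<Sum>j<Suc n. \<rho> ^ i * \<tau> ^ j * C $$ (i, j)) = e" by blast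
  let ?x = "mat 1 m (\<lambda>(_, j). u * \<rho> ^ Suc j)" and ?y = "mat n 1 (\<lambda>(i, _). \<tau> ^ Suc i)"
  let ?P = "four_block_mat (u \<cdot>\<^sub>m 1\<^sub>m 1) ?x (0\<^sub>m m 1) (1\<^sub>m m)"
  let ?Q = "four_block_mat (1\<^sub>m 1) (0\<^sub>m 1 n) ?y (1\<^sub>m n)"
  have x: "?x \<in> carrier_mat 1 m" and y: "?y \<in> carrier_mat n 1" by auto
  have P: "?P \<in> carrier_mat (Suc m) (Suc m)" and Q: "?Q \<in> carrier_mat (Suc n) (Suc n)" by auto
  obtain P' where P': "P' \<in> carrier_mat (Suc m) (Suc m)" "?P * P' = 1\<^sub>m (Suc m)" "P' * ?P = 1\<^sub>m (Suc m)"
    using unit_first_row_invertible[OF x u] by (elim bexE conjE)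
  obtain Q' where Q': "Q' \<in> carrier_mat (Suc n) (Suc n)" "?Q * Q' = 1\<^sub>m (Suc n)" "Q' * ?Q = 1\<^sub>m (Suc n)"
    using unit_first_col_invertible[OF y] by (elim bexE conjE)
  let ?D = "?P * C * ?Q"
  have eqv: "mat_equiv (Suc m) (Suc n) C ?D"
    by (rule mat_equivI[OF C P P'(1) Q Q'(1) P'(2,3) Q'(2,3) refl])
  have D: "?D \<in> carrier_mat (Suc m) (Suc n)" by (intro mult_carrier_mat[OF _ Q] mult_carrier_mat[OF P C])
  have "?D $$ (0, 0) = e" unfolding pivot_entry[OF C] by (rule sum)
  from clear_row_col[OF D smult_mat_equiv_fixed[OF eqv e(2)] this]
  obtain Z where Z: "Z \<in> carrier_mat m n" "e \<cdot>\<^sub>m Z = Z"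
    and eqv': "mat_equiv (Suc m) (Suc n) ?D (four_block_mat (e \<cdot>\<^sub>m 1\<^sub>m 1) (0\<^sub>m 1 n) (0\<^sub>m m 1) Z)"
    by (elim bexE conjE)
  show ?thesis by (rule exI[of _ e], rule exI[of _ Z], intro conjI e(1) Z mat_equiv_trans[OF eqv eqv'])
qed

lemma regular_block:
  fixes Z :: "'a::comm_ring_1 mat"
  assumes Z: "Z \<in> carrier_mat m n" and X: "X \<in> carrier_mat (Suc n) (Suc m)"
    and D: "D = four_block_mat (e \<cdot>\<^sub>m 1\<^sub>m 1) (0\<^sub>m 1 n) (0\<^sub>m m 1) Z" and DXD: "D * X * D = D"
  shows "\<exists>Y\<in>carrier_mat n m. Z * Y * Z = Z"
proof -
  define Y where "Y = mat n m (\<lambda>(i, j). X $$ (Suc i, Suc j))"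
  have Y: "Y \<in> carrier_mat n m" by (simp add: Y_def)
  have Dc: "D \<in> carrier_mat (Suc m) (Suc n)" using Z unfolding D by auto
  have "Z * Y * Z = Z"
  proof (rule eq_matI)
    fix i j assume "i < dim_row Z" "j < dim_col Z"
    hence ij: "i < m" "j < n" using Z by auto
    have "Z $$ (i, j) = (D * X * D) $$ (Suc i, Suc j)" unfolding DXD using ij Z unfolding D by simp
    also have "\<dots> = (\<Sum>l<Suc m. \<Sum>k<Suc n. D $$ (Suc i, k) * D $$ (l, Suc j) * X $$ (k, l))"
      using ij by (intro triple_mat_mult_index[OF Dc X Dc]) auto
    also have "\<dots> = (\<Sum>l<m. \<Sum>k<n. Z $$ (i, k) * Z $$ (l, j) * Y $$ (k, l))"
      using ij Z unfolding D by (simp add: sum.lessThan_Suc_shift Y_def del: sum.lessThan_Suc)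
    also have "\<dots> = (Z * Y * Z) $$ (i, j)"
      using ij by (intro triple_mat_mult_index[OF Z Y Z, symmetric]) auto
    finally show "(Z * Y * Z) $$ (i, j) = Z $$ (i, j)" by simp
  qed (use Z Y in auto)
  thus ?thesis using Y by blast
qed

definition diag_rect :: "nat \<Rightarrow> nat \<Rightarrow> (nat \<Rightarrow> 'a::zero) \<Rightarrow> 'a mat" where
  "diag_rect m n r = mat m n (\<lambda>(i, j). if i = j then r i else 0)"

text \<open>
  The divisibility \<open>r i * r (Suc i) = r (Suc i)\<close> comes for free: the pivot \<open>e\<close> fixes all entries of the remaining
  block \<open>Z\<close>, hence all entries of every matrix equivalent to \<open>Z\<close>, in particular the next diagonal entry.
\<close>

lemma regular_equiv_diag:
  fixes C :: "'a::comm_ring_1 nagata mat"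
  assumes "C \<in> carrier_mat m n" "\<exists>B\<in>carrier_mat n m. C * B * C = C"
  shows "\<exists>r. mat_equiv m n C (diag_rect m n r) \<and> (\<forall>i<min m n. r i * r i = r i) \<and>
    (\<forall>i. Suc i < min m n \<longrightarrow> r i * r (Suc i) = r (Suc i))"
  using assms
proof (induction m arbitrary: n C)
  case 0
  hence "C = diag_rect 0 n (\<lambda>_. 0)" by (intro eq_matI) (auto simp: diag_rect_def)
  thus ?case using mat_equiv_refl[OF "0.prems"(1)] by (intro exI[of _ "\<lambda>_. 0"]) auto
next
  case (Suc m)
  show ?case
  proof (cases n)
    case 0
    hence "C = diag_rect (Suc m) n (\<lambda>_. 0)"
      using Suc.prems by (intro eq_matI) (auto simp: diag_rect_def)
    thus ?thesis using mat_equiv_refl[OF Suc.prems(1)] by (intro exI[of _ "\<lambda>_. 0"]) auto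
  next
    case n: (Suc n')
    obtain B where C: "C \<in> carrier_mat (Suc m) (Suc n')" and B: "B \<in> carrier_mat (Suc n') (Suc m)" "C * B * C = C"
      using Suc.prems unfolding n by blast
    let ?D = "\<lambda>e Z. four_block_mat (e \<cdot>\<^sub>m 1\<^sub>m 1) (0\<^sub>m 1 n') (0\<^sub>m m 1) Z"
    obtain e Z where e: "e * e = e" and Z: "Z \<in> carrier_mat m n'" "e \<cdot>\<^sub>m Z = Z"
      and eqv: "mat_equiv (Suc m) (Suc n') C (?D e Z)"
      using regular_equiv_pivot_block[OF C B] by blast
    obtain X where "X \<in> carrier_mat (Suc n') (Suc m)" "?D e Z * X * ?D e Z = ?D e Z"
      using mat_equiv_regular[OF eqv B] by blast
    hence "\<exists>Y\<in>carrier_mat n' m. Z * Y * Z = Z" using regular_block[OF Z(1) _ refl] by blast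
    then obtain r where r: "mat_equiv m n' Z (diag_rect m n' r)" "\<forall>i<min m n'. r i * r i = r i"
      "\<forall>i. Suc i < min m n' \<longrightarrow> r i * r (Suc i) = r (Suc i)"
      using Suc.IH[OF Z(1)] by blast
    have er: "e * r 0 = r 0" if "0 < min m n'"
      using that arg_cong[OF smult_mat_equiv_fixed[OF r(1) Z(2)], of "\<lambda>M. M $$ (0, 0)"]
      by (simp add: diag_rect_def)
    let ?r = "case_nat e r"
    have "?D e (diag_rect m n' r) = diag_rect (Suc m) n ?r"
      unfolding n by (intro eq_matI) (auto simp: diag_rect_def split: nat.splits)
    hence "mat_equiv (Suc m) n C (diag_rect (Suc m) n ?r)"
      using mat_equiv_trans[OF eqv mat_equiv_block[OF r(1)]] n by simp
    moreover have "?r i * ?r i = ?r i" if "i < min (Suc m) n" for i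
      using that e r(2) n by (cases i) auto
    moreover have "?r i * ?r (Suc i) = ?r (Suc i)" if "Suc i < min (Suc m) n" for i
      using that er r(3) n by (cases i) auto
    ultimately show ?thesis by blast
  qed
qed

section \<open>Bases and quasi-simple matrices\<close>

lemma free_basis_iff:
  fixes es :: "'a::comm_ring_1 vec list"
  shows "free_basis d es \<longleftrightarrow> (\<exists>Q\<in>carrier_mat d d. \<exists>Q'\<in>carrier_mat d d.
    es = cols Q \<and> Q * Q' = 1\<^sub>m d \<and> Q' * Q = 1\<^sub>m d)"
proof
  assume "\<exists>Q\<in>carrier_mat d d. \<exists>Q'\<in>carrier_mat d d. es = cols Q \<and> Q * Q' = 1\<^sub>m d \<and> Q' * Q = 1\<^sub>m d"
  then obtain Q Q' where Q: "Q \<in> carrier_mat d d" "Q' \<in> carrier_mat d d"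
    "es = cols Q" "Q * Q' = 1\<^sub>m d" "Q' * Q = 1\<^sub>m d" by blast
  have es: "mat_of_cols d es = Q" using Q by auto
  have "\<exists>!c. c \<in> carrier_vec d \<and> Q *\<^sub>v c = v" if v: "v \<in> carrier_vec d" for v
  proof (rule ex1I[of _ "Q' *\<^sub>v v"])
    show "Q' *\<^sub>v v \<in> carrier_vec d \<and> Q *\<^sub>v (Q' *\<^sub>v v) = v"
      using Q v assoc_mult_mat_vec[OF Q(1,2) v] by simp
    fix c assume c: "c \<in> carrier_vec d \<and> Q *\<^sub>v c = v"
    thus "c = Q' *\<^sub>v v" using Q assoc_mult_mat_vec[OF Q(2,1), of c] by auto
  qed
  thus "free_basis d es" unfolding free_basis_def es using Q(1,3) by (auto simp: cols_def)
next
  assume fb: "free_basis d es"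
  let ?Q = "mat_of_cols d es"
  have Q: "?Q \<in> carrier_mat d d" and esd: "length es = d" "set es \<subseteq> carrier_vec d"
    using fb unfolding free_basis_def by auto
  have ex1: "\<exists>!c. c \<in> carrier_vec d \<and> ?Q *\<^sub>v c = v" if "v \<in> carrier_vec d" for v
    using fb that unfolding free_basis_def by blast
  then have "\<forall>j. \<exists>c. c \<in> carrier_vec d \<and> ?Q *\<^sub>v c = unit_vec d j" by (meson unit_vec_carrier)
  then obtain c where c: "\<And>j. c j \<in> carrier_vec d" "\<And>j. ?Q *\<^sub>v c j = unit_vec d j" by metis
  define Q' where "Q' = mat d d (\<lambda>(i, j). c j $ i)"
  have Q': "Q' \<in> carrier_mat d d" by (simp add: Q'_def)
  have QQ': "?Q * Q' = 1\<^sub>m d"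
  proof (rule eq_matI)
    fix i j assume "i < dim_row (1\<^sub>m d)" "j < dim_col (1\<^sub>m d)"
    hence ij: "i < d" "j < d" by auto
    have "col Q' j = c j" using ij c(1)[of j] by (intro eq_vecI) (auto simp: Q'_def)
    hence "(?Q * Q') $$ (i, j) = (?Q *\<^sub>v c j) $ i" using ij Q Q' by simp
    thus "(?Q * Q') $$ (i, j) = 1\<^sub>m d $$ (i, j)" unfolding c(2) using ij by simp
  qed (use Q Q' in auto)
  have "Q' * ?Q = 1\<^sub>m d"
  proof (rule mat_eq_vecI)
    fix v :: "'a vec" assume v: "v \<in> carrier_vec d"
    have w: "Q' * ?Q *\<^sub>v v \<in> carrier_vec d" "?Q *\<^sub>v v \<in> carrier_vec d" using Q Q' v by auto
    have "?Q *\<^sub>v (Q' * ?Q *\<^sub>v v) = ?Q * Q' *\<^sub>v (?Q *\<^sub>v v)"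
      using assoc_mult_mat_vec[OF Q' Q v] assoc_mult_mat_vec[OF Q Q' w(2)] by simp
    hence "?Q *\<^sub>v (Q' * ?Q *\<^sub>v v) = ?Q *\<^sub>v v" using QQ' w by simp
    thus "Q' * ?Q *\<^sub>v v = 1\<^sub>m d *\<^sub>v v" using ex1[OF w(2)] v w(1) by auto
  qed (use Q Q' in auto)
  moreover have "es = cols ?Q" using esd by simp
  ultimately show "\<exists>Q\<in>carrier_mat d d. \<exists>Q'\<in>carrier_mat d d. es = cols Q \<and> Q * Q' = 1\<^sub>m d \<and> Q' * Q = 1\<^sub>m d"
    using Q Q' QQ' by blast
qed

text \<open>
  Placing the two bases as columns of invertible matrices \<open>Q\<close> and \<open>F\<close>, the vector equations in the definition of
  quasi-simple maps say \<open>C * Q = F * D\<close> with \<open>D\<close> diagonal.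
\<close>

lemma quasi_simple_iff_equiv_diag:
  fixes C :: "'a::comm_ring_1 mat"
  assumes C: "C \<in> carrier_mat m n"
  shows "quasi_simple C \<longleftrightarrow> (\<exists>r. mat_equiv m n C (diag_rect m n r) \<and> (\<forall>i<min m n. r i * r i = r i) \<and>
    (\<forall>i. Suc i < min m n \<longrightarrow> r i * r (Suc i) = r (Suc i)))"
proof -
  have key: "((\<forall>i<min m n. C *\<^sub>v (cols Q ! i) = r i \<cdot>\<^sub>v (cols F ! i)) \<and>
      (\<forall>i. min m n \<le> i \<and> i < n \<longrightarrow> C *\<^sub>v (cols Q ! i) = 0\<^sub>v m)) \<longleftrightarrow> C * Q = F * diag_rect m n r"
    if Q: "Q \<in> carrier_mat n n" and F: "F \<in> carrier_mat m m" for Q F r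
  proof -
    have D: "diag_rect m n r \<in> carrier_mat m n" by (simp add: diag_rect_def)
    have FD: "(F * diag_rect m n r) $$ (i, j) = (if j < m then r j * F $$ (i, j) else 0)"
      if "i < m" "j < n" for i j
    proof -
      have "(F * diag_rect m n r) $$ (i, j) = (\<Sum>k<m. if k = j then r j * F $$ (i, j) else 0)"
        unfolding mat_mult_index_sum[OF F D that] using that
        by (intro sum.cong refl) (simp add: diag_rect_def)
      thus ?thesis by auto
    qed
    have CQ: "C *\<^sub>v (cols Q ! j) = col (C * Q) j" if "j < n" for j
      using that C Q by (intro eq_vecI) auto
    show ?thesis
    proof
      assume *: "(\<forall>i<min m n. C *\<^sub>v (cols Q ! i) = r i \<cdot>\<^sub>v (cols F ! i)) \<and>
        (\<forall>i. min m n \<le> i \<and> i < n \<longrightarrow> C *\<^sub>v (cols Q ! i) = 0\<^sub>v m)"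
      show "C * Q = F * diag_rect m n r"
      proof (rule eq_matI)
        fix i j assume "i < dim_row (F * diag_rect m n r)" "j < dim_col (F * diag_rect m n r)"
        hence ij: "i < m" "j < n" using F D by auto
        have "(C * Q) $$ (i, j) = (C *\<^sub>v (cols Q ! j)) $ i" unfolding CQ[OF ij(2)] using ij C Q by simp
        also have "\<dots> = (if j < m then r j * F $$ (i, j) else 0)"
          using * ij F by (cases "j < m") auto
        finally show "(C * Q) $$ (i, j) = (F * diag_rect m n r) $$ (i, j)" using FD[OF ij] by simp
      qed (use C Q F D in auto)
    next
      assume eq: "C * Q = F * diag_rect m n r"
      have "C *\<^sub>v (cols Q ! j) = vec m (\<lambda>i. if j < m then r j * F $$ (i, j) else 0)" if j: "j < n" for j
        unfolding CQ[OF j] eq using j F D FD by (intro eq_vecI) auto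
      moreover have "vec m (\<lambda>i. if j < m then r j * F $$ (i, j) else 0) =
          (if j < m then r j \<cdot>\<^sub>v (cols F ! j) else 0\<^sub>v m)" for j
        using F by (intro eq_vecI) auto
      ultimately show "(\<forall>i<min m n. C *\<^sub>v (cols Q ! i) = r i \<cdot>\<^sub>v (cols F ! i)) \<and>
        (\<forall>i. min m n \<le> i \<and> i < n \<longrightarrow> C *\<^sub>v (cols Q ! i) = 0\<^sub>v m)" by auto
    qed
  qed
  have dims: "dim_row C = m" "dim_col C = n" using C by auto
  show ?thesis
  proof
    assume "quasi_simple C"
    then obtain es fs r where es: "free_basis n es" and fs: "free_basis m fs"
      and r: "\<forall>i<min m n. r i * r i = r i" "\<forall>i. Suc i < min m n \<longrightarrow> r i * r (Suc i) = r (Suc i)"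
      and m: "\<forall>i<min m n. C *\<^sub>v (es ! i) = r i \<cdot>\<^sub>v (fs ! i)"
        "\<forall>i. min m n \<le> i \<and> i < n \<longrightarrow> C *\<^sub>v (es ! i) = 0\<^sub>v m"
      unfolding quasi_simple_def Let_def dims by blast
    obtain Q Q' where Q: "Q \<in> carrier_mat n n" "Q' \<in> carrier_mat n n" "es = cols Q" "Q * Q' = 1\<^sub>m n" "Q' * Q = 1\<^sub>m n"
      using es unfolding free_basis_iff by blast
    obtain F F' where F: "F \<in> carrier_mat m m" "F' \<in> carrier_mat m m" "fs = cols F" "F * F' = 1\<^sub>m m" "F' * F = 1\<^sub>m m"
      using fs unfolding free_basis_iff by blast
    have eq: "C * Q = F * diag_rect m n r" using key[OF Q(1) F(1), of r] m unfolding Q(3) F(3) by blast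
    have "F' * C * Q = F' * (C * Q)" using F(2) Q(1) C by (intro assoc_mult_mat)
    also have "\<dots> = diag_rect m n r"
      unfolding eq using F by (intro inverse_mult_cancel[OF F(5)]) (auto simp: diag_rect_def)
    finally have "mat_equiv m n C (diag_rect m n r)"
      by (rule mat_equivI[OF C F(2,1) Q(1,2) F(5,4) Q(4,5)])
    thus "\<exists>r. mat_equiv m n C (diag_rect m n r) \<and> (\<forall>i<min m n. r i * r i = r i) \<and>
      (\<forall>i. Suc i < min m n \<longrightarrow> r i * r (Suc i) = r (Suc i))" using r by blast
  next
    assume "\<exists>r. mat_equiv m n C (diag_rect m n r) \<and> (\<forall>i<min m n. r i * r i = r i) \<and>
      (\<forall>i. Suc i < min m n \<longrightarrow> r i * r (Suc i) = r (Suc i))"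
    then obtain r where eqv: "mat_equiv m n C (diag_rect m n r)" and r: "\<forall>i<min m n. r i * r i = r i"
      "\<forall>i. Suc i < min m n \<longrightarrow> r i * r (Suc i) = r (Suc i)" by blast
    from eqv obtain P P' Q Q' where 1: "C \<in> carrier_mat m n" "P \<in> carrier_mat m m" "P' \<in> carrier_mat m m"
      "Q \<in> carrier_mat n n" "Q' \<in> carrier_mat n n"
      "P * P' = 1\<^sub>m m" "P' * P = 1\<^sub>m m" "Q * Q' = 1\<^sub>m n" "Q' * Q = 1\<^sub>m n" "P * C * Q = diag_rect m n r"
      by (rule mat_equivE)
    have "P' * diag_rect m n r = P' * (P * (C * Q))"
      unfolding 1(10)[symmetric] using 1(1-5) by (simp add: assoc_mult_mat[of P m m C n Q n])
    also have "\<dots> = C * Q" using 1(1-5) by (intro inverse_mult_cancel[OF 1(7)]) auto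
    finally have eq: "C * Q = P' * diag_rect m n r" ..
    have "free_basis n (cols Q)" "free_basis m (cols P')"
      unfolding free_basis_iff using 1 by blast+
    thus "quasi_simple C"
      unfolding quasi_simple_def Let_def dims using r key[OF 1(4,3), of r] eq by blast
  qed
qed

lemma quasi_simple_imp_locally_simple:
  fixes C :: "'a::comm_ring_1 mat"
  assumes C: "C \<in> carrier_mat m n" and "quasi_simple C"
  shows "locally_simple C"
proof -
  obtain r where eqv: "mat_equiv m n C (diag_rect m n r)" and r: "\<forall>i<min m n. r i * r i = r i"
    using assms(2) unfolding quasi_simple_iff_equiv_diag[OF C] by blast
  have B: "diag_rect n m (\<lambda>_. 1 :: 'a) \<in> carrier_mat n m" by (simp add: diag_rect_def)
  have D: "diag_rect m n r \<in> carrier_mat m n" by (simp add: diag_rect_def)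
  have "diag_rect m n r * diag_rect n m (\<lambda>_. 1) * diag_rect m n r = diag_rect m n r" (is "?L = ?R")
  proof (rule eq_matI)
    fix i j assume "i < dim_row ?R" "j < dim_col ?R"
    hence ij: "i < m" "j < n" by (auto simp: diag_rect_def)
    have "?L $$ (i, j) = (\<Sum>l<m. \<Sum>k<n. if k = i then (if l = j then (if i = j then r i * r i else 0) else 0) else 0)"
      unfolding triple_mat_mult_index[OF D B D ij]
      using ij by (intro sum.cong refl) (auto simp: diag_rect_def)
    also have "\<dots> = ?R $$ (i, j)"
      using ij r by (cases "i = j") (auto simp: diag_rect_def)
    finally show "?L $$ (i, j) = ?R $$ (i, j)" .
  qed (auto simp: diag_rect_def)
  from mat_equiv_regular[OF mat_equiv_sym[OF eqv] B this] show ?thesis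
    unfolding locally_simple_iff[OF C] .
qed

section \<open>Left inverses by testing modulo ideals\<close>

text \<open>
  The radical of \<open>I\<close>.
\<close>

lemma semiprime_ideal_above:
  fixes I :: "'a::comm_ring_1 set"
  assumes I: "ideal I class_ring" "1 \<notin> I"
  shows "\<exists>J. ideal J class_ring \<and> I \<subseteq> J \<and> 1 \<notin> J \<and> (\<forall>a. a * a \<in> J \<longrightarrow> a \<in> J)"
proof (intro exI conjI allI impI subsetI)
  let ?J = "{a. \<exists>n. a ^ n \<in> I}"
  note mem = ideal_mem[OF I(1)]
  show "ideal ?J class_ring"
    unfolding ideal_class_ring_iff
  proof (intro conjI ballI allI)
    show "0 \<in> ?J" using mem(1) by (auto intro: exI[of _ 1])
  next
    fix a b assume "a \<in> ?J" "b \<in> ?J"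
    then obtain p q where p: "a ^ p \<in> I" and q: "b ^ q \<in> I" by blast
    have "of_nat (p + q choose k) * a ^ k * b ^ (p + q - k) \<in> I" for k
    proof (cases "p \<le> k")
      case True
      hence "a ^ k = a ^ (k - p) * a ^ p" by (simp flip: power_add)
      thus ?thesis using p mem by simp
    next
      case False
      hence "b ^ (p + q - k) = b ^ (p - k) * b ^ q" by (simp flip: power_add)
      thus ?thesis using q mem by simp
    qed
    hence "(a + b) ^ (p + q) \<in> I"
      unfolding binomial_ring by (intro ideal_sum_mem[OF I(1)])
    thus "a + b \<in> ?J" by blast
  next
    fix a x assume "a \<in> ?J"
    then obtain p where "a ^ p \<in> I" by blast
    hence "(x * a) ^ p \<in> I" using mem by (simp add: power_mult_distrib)
    thus "x * a \<in> ?J" by blast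
  qed
  show "1 \<notin> ?J" using I(2) by simp
  show "a \<in> ?J" if "a \<in> I" for a using that by (auto intro: exI[of _ 1])
  show "a \<in> ?J" if aa: "a * a \<in> ?J" for a
  proof -
    obtain p where "(a * a) ^ p \<in> I" using aa by blast
    hence "a ^ (2 * p) \<in> I" by (simp add: power_mult power2_eq_square)
    thus ?thesis by blast
  qed
qed

text \<open>
  Elimination of the last column. If its entries lay in the extension of a proper ideal, then the last unit
  vector would contradict injectivity modulo the extension of the radical of that ideal. So \<open>spread_unit\<close> gives a row
  vector \<open>v\<close> with \<open>v M = (h, 1)\<close>. Subtracting the last column times \<open>h\<close> from the other columns keeps injectivity, and a left
  inverse \<open>L'\<close> of the result is corrected to annihilate the last column.
\<close>

lemma left_inverse_from_injectivity:
  fixes M :: "nat \<Rightarrow> nat \<Rightarrow> 'a::comm_ring_1 nagata"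
  assumes "\<And>I x. ideal I (class_ring :: 'a ring) \<Longrightarrow> (\<And>a. a * a \<in> I \<Longrightarrow> a \<in> I) \<Longrightarrow>
      (\<And>i. i < m \<Longrightarrow> (\<Sum>j<n. M i j * x j) \<in> ext_ideal I) \<Longrightarrow> (\<And>j. j < n \<Longrightarrow> x j \<in> ext_ideal I)"
  shows "\<exists>L. \<forall>k<n. \<forall>j<n. (\<Sum>i<m. L k i * M i j) = (if k = j then 1 else 0)"
  using assms
proof (induction n arbitrary: M)
  case 0
  show ?case by simp
next
  case (Suc n)
  note inj = Suc.prems
  have "\<exists>N u. u * (\<Sum>i<m. nagata_t ^ (N * i) * M i n) = 1"
  proof (rule spread_unit, rule ccontr)
    fix I :: "'a set"
    assume I: "ideal I class_ring" and c: "\<And>i. i < m \<Longrightarrow> M i n \<in> ext_ideal I" and "1 \<notin> I"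
    then obtain J where J: "ideal J class_ring" "I \<subseteq> J" "1 \<notin> J" "\<And>a. a * a \<in> J \<Longrightarrow> a \<in> J"
      using semiprime_ideal_above[OF I] by blast
    have sub: "ext_ideal I \<subseteq> ext_ideal J" using J(2) unfolding ext_ideal_def by blast
    \<comment> \<open>The \<open>n\<close>-th coordinate of the unit vector tested below.\<close>
    have "(if n = n then 1 else 0) \<in> ext_ideal J"
    proof (rule inj[OF J(1,4), of "\<lambda>j. if j = n then 1 else 0"])
      fix i assume "i < m"
      have "(\<Sum>j<Suc n. M i j * (if j = n then 1 else 0)) = M i n" by simp
      thus "(\<Sum>j<Suc n. M i j * (if j = n then 1 else 0)) \<in> ext_ideal J"
        using c[OF \<open>i < m\<close>] sub by auto
    qed auto
    thus False using one_in_ext_ideal[OF J(1)] J(3) by simp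
  qed
  then obtain N u where u: "u * (\<Sum>i<m. nagata_t ^ (N * i) * M i n) = 1" by blast
  define v where "v i = u * nagata_t ^ (N * i)" for i
  have vn: "(\<Sum>i<m. v i * M i n) = 1"
    using u by (simp add: v_def sum_distrib_left mult.assoc)
  define h where "h j = (\<Sum>i<m. v i * M i j)" for j
  define M' where "M' i j = M i j - M i n * h j" for i j
  have "\<exists>L. \<forall>k<n. \<forall>j<n. (\<Sum>i<m. L k i * M' i j) = (if k = j then 1 else 0)"
  proof (rule Suc.IH)
    fix I :: "'a set" and x j
    assume I: "ideal I class_ring" "\<And>a. a * a \<in> I \<Longrightarrow> a \<in> I"
      and M'x: "\<And>i. i < m \<Longrightarrow> (\<Sum>j<n. M' i j * x j) \<in> ext_ideal I" and j: "j < n"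
    let ?x = "\<lambda>j. if j = n then - (\<Sum>j<n. h j * x j) else x j"
    have "?x j \<in> ext_ideal I"
    proof (rule inj[OF I, of ?x])
      fix i assume i: "i < m"
      have "(\<Sum>j<Suc n. M i j * ?x j) = (\<Sum>j<n. M' i j * x j)"
        by (simp add: M'_def left_diff_distrib sum_subtractf sum_distrib_left mult.assoc)
      thus "(\<Sum>j<Suc n. M i j * ?x j) \<in> ext_ideal I" using M'x[OF i] by (simp only:)
    qed (use j in auto)
    thus "x j \<in> ext_ideal I" using j by simp
  qed
  then obtain L' where L': "\<And>k j. k < n \<Longrightarrow> j < n \<Longrightarrow> (\<Sum>i<m. L' k i * M' i j) = (if k = j then 1 else 0)"
    by blast
  define K where "K k i = L' k i - (\<Sum>l<m. L' k l * M l n) * v i" for k i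
  have K: "(\<Sum>i<m. K k i * M i j) = (\<Sum>i<m. L' k i * M i j) - (\<Sum>l<m. L' k l * M l n) * h j" for k j
    by (simp add: K_def h_def left_diff_distrib sum_subtractf mult.assoc flip: sum_distrib_left)
  have Kn: "(\<Sum>i<m. K k i * M i n) = 0" for k
    unfolding K by (simp add: h_def vn)
  have Kj: "(\<Sum>i<m. K k i * M i j) = (if k = j then 1 else 0)" if "k < n" "j < n" for k j
  proof -
    have "(\<Sum>i<m. K k i * M i j) = (\<Sum>i<m. L' k i * M' i j)"
      unfolding K by (simp add: M'_def right_diff_distrib sum_subtractf sum_distrib_right mult.assoc)
    thus ?thesis using L'[OF that] by simp
  qed
  define L where "L k i = (if k < n then K k i else v i - (\<Sum>l<n. h l * K l i))" for k i
  have "(\<Sum>i<m. L k i * M i j) = (if k = j then 1 else 0)" if kj: "k < Suc n" "j < Suc n" for k j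
  proof (cases "k < n")
    case True
    thus ?thesis using kj Kn[of k] Kj[of k j] by (cases "j = n") (auto simp: L_def)
  next
    case False
    have "(\<Sum>i<m. L k i * M i j) = h j - (\<Sum>i<m. \<Sum>l<n. h l * (K l i * M i j))"
      using False by (simp add: L_def h_def left_diff_distrib sum_subtractf sum_distrib_right mult.assoc)
    also have "(\<Sum>i<m. \<Sum>l<n. h l * (K l i * M i j)) = (\<Sum>l<n. h l * (\<Sum>i<m. K l i * M i j))"
      by (subst sum.swap) (simp add: sum_distrib_left)
    also have "\<dots> = (if j = n then 0 else h j)"
    proof (cases "j = n")
      case True
      thus ?thesis by (simp add: Kn)
    next
      case False
      hence "(\<Sum>l<n. h l * (\<Sum>i<m. K l i * M i j)) = (\<Sum>l<n. if l = j then h j else 0)"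
        using kj by (intro sum.cong) (auto simp: Kj)
      thus ?thesis using False kj by simp
    qed
    finally show ?thesis using False kj vn by (cases "j = n") (auto simp: h_def)
  qed
  thus ?case by blast
qed

section \<open>Nondegeneracy of weighted forms\<close>

text \<open>
  Here \<open>y j k\<close> is the coefficient of \<open>t^k\<close> in the \<open>j\<close>-th coordinate of a polynomial vector \<open>y\<close>, the columns of \<open>a\<close>
  span a submodule \<open>V\<close>, \<open>orth\<close> says that \<open>y\<close> is orthogonal to \<open>V\<close> for the form with diagonal entries \<open>t^(d j)\<close>, and
  \<open>img\<close> says that all coefficient vectors of \<open>y\<close> lie in \<open>V\<close>, everything modulo \<open>I\<close>. Take the least \<open>k\<close> with
  \<open>y j k \<notin> I\<close> for some \<open>j\<close>, and for it the \<open>j\<close> of least weight. Pairing the vector \<open>y _ k\<close>, which lies in \<open>V\<close>, with \<open>y\<close> and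
  reading off the coefficient of \<open>t^(k + d j)\<close> leaves only the square of \<open>y j k\<close>: coordinates of smaller weight
  vanish in \<open>y _ k\<close>, and those of larger weight would need a power of \<open>t\<close> below \<open>t^k\<close>. This is where
  the weights have to be distinct. The statement is proved by induction on \<open>k\<close>, then on \<open>d j\<close>.
\<close>

lemma weighted_form_anisotropic:
  fixes a :: "nat \<Rightarrow> nat \<Rightarrow> 'a::comm_ring_1" and y z :: "nat \<Rightarrow> nat \<Rightarrow> 'a"
  assumes I: "ideal I class_ring" and semiprime: "\<And>x. x * x \<in> I \<Longrightarrow> x \<in> I"
    and d: "inj_on d {..<m}"
    and orth: "\<And>i l. i < n \<Longrightarrow> (\<Sum>j<m. a j i * (if d j \<le> l then y j (l - d j) else (0 :: 'a))) \<in> I"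
    and img: "\<And>j k. j < m \<Longrightarrow> y j k - (\<Sum>i<n. a j i * z k i) \<in> I"
    and j: "j < m"
  shows "y j k \<in> I"
  using j
proof (induction k arbitrary: j rule: less_induct)
  case (less k)
  note IHk = less.IH
  from less.prems show ?case
  proof (induction "d j" arbitrary: j rule: less_induct)
    case less
    define Y where "Y j' = (if d j' \<le> k + d j then y j' (k + d j - d j') else 0)" for j'
    have mem: "(\<Sum>j'<m. y j' k * Y j') \<in> I"
    proof -
      have "(\<Sum>j'<m. y j' k * Y j') =
          (\<Sum>j'<m. (y j' k - (\<Sum>i<n. a j' i * z k i)) * Y j') + (\<Sum>j'<m. \<Sum>i<n. z k i * (a j' i * Y j'))"
        unfolding sum.distrib[symmetric]
        by (intro sum.cong refl) (simp add: left_diff_distrib sum_distrib_right mult_ac(1,3) mult.left_commute[of "z _ _"])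
      also have "(\<Sum>j'<m. \<Sum>i<n. z k i * (a j' i * Y j')) = (\<Sum>i<n. z k i * (\<Sum>j'<m. a j' i * Y j'))"
        by (subst sum.swap) (simp add: sum_distrib_left)
      also have "(\<Sum>j'<m. (y j' k - (\<Sum>i<n. a j' i * z k i)) * Y j') + \<dots> \<in> I"
      proof (rule ideal_mem(2)[OF I])
        show "(\<Sum>j'<m. (y j' k - (\<Sum>i<n. a j' i * z k i)) * Y j') \<in> I"
          by (intro ideal_sum_mem[OF I] ideal_mem(4)[OF I] img) simp
        show "(\<Sum>i<n. z k i * (\<Sum>j'<m. a j' i * Y j')) \<in> I"
          unfolding Y_def by (intro ideal_sum_mem[OF I] ideal_mem(3)[OF I] orth) simp
      qed
      finally show ?thesis .
    qed
    have rest: "y j' k * Y j' \<in> I" if j': "j' \<in> {..<m} - {j}" for j'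
    proof -
      have "d j' \<noteq> d j" using inj_onD[OF d, of j' j] j' less.prems by auto
      then consider "d j' < d j" | "d j' > d j" by linarith
      thus ?thesis
      proof cases
        case 1
        have "y j' k \<in> I" using less.hyps[OF 1] j' by simp
        thus ?thesis by (rule ideal_mem(4)[OF I])
      next
        case 2
        have "Y j' \<in> I"
          using IHk[of "k + d j - d j'" j'] 2 j' ideal_mem(1)[OF I] by (auto simp: Y_def)
        thus ?thesis by (rule ideal_mem(3)[OF I])
      qed
    qed
    have "y j k * y j k = (\<Sum>j'<m. y j' k * Y j') - (\<Sum>j'\<in>{..<m} - {j}. y j' k * Y j')"
      using less.prems by (simp add: sum.remove[of "{..<m}" j] Y_def)
    also have "\<dots> \<in> I"
      by (intro ideal_diff_mem[OF I] mem ideal_sum_mem[OF I] rest)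
    finally show ?case by (rule semiprime)
  qed
qed

text \<open>
  The left inverse criterion is applied to the matrix \<open>M\<close> that stacks \<open>C\<^sup>T * D\<close> on top of \<open>1 - C * B\<close>: a vector killed
  by \<open>M\<close> modulo \<open>I\<close> is fixed by the projection \<open>C * B\<close>, so it lies in the image of \<open>C\<close>, and it is orthogonal to
  this image. A left inverse \<open>L1 * (C\<^sup>T * D) + L2 * (1 - C * B) = 1\<close> multiplied by \<open>C\<close> on the right loses its second
  summand.
\<close>

lemma gram_left_cancel:
  fixes A B :: "'a::comm_ring_1 mat"
  assumes A: "A \<in> carrier_mat m n" and B: "B \<in> carrier_mat n m" and ABA: "A * B * A = A"
    and d: "inj_on d {..<m}"
  defines "C \<equiv> map_mat nagata_const A"
  shows "\<exists>L\<in>carrier_mat m n. L * (transpose_mat C * mat_diag m (\<lambda>i. nagata_t ^ d i) * C) = C"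
proof -
  interpret nc: comm_ring_hom "nagata_const :: 'a \<Rightarrow> 'a nagata" by (rule comm_ring_hom_nagata_const)
  let ?P = "A * B" and ?D = "mat_diag m (\<lambda>i. nagata_t ^ d i) :: 'a nagata mat"
  have P: "?P \<in> carrier_mat m m" using A B by simp
  define M where "M i j = (if i < n then nagata_const (A $$ (j, i)) * nagata_t ^ d j
    else (if i - n = j then 1 else 0) - nagata_const (?P $$ (i - n, j)))" for i j
  have "\<exists>L. \<forall>k<m. \<forall>j<m. (\<Sum>i<n + m. L k i * M i j) = (if k = j then 1 else 0)"
  proof (rule left_inverse_from_injectivity)
    fix I :: "'a set" and x j
    assume I: "ideal I class_ring" "\<And>a. a * a \<in> I \<Longrightarrow> a \<in> I"
      and Mx: "\<And>i. i < n + m \<Longrightarrow> (\<Sum>j<m. M i j * x j) \<in> ext_ideal I" and j: "j < m"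
    obtain s p where s: "primitive_poly s"
      and p: "\<And>j. j < m \<Longrightarrow> nagata_poly s * x j = nagata_poly (p j)"
      using common_denominator[of m x] by blast
    have "coeff (p j) k \<in> I" for k
    proof (rule weighted_form_anisotropic[OF I d, where y = "\<lambda>j k. coeff (p j) k" and n = n
          and a = "\<lambda>j i. A $$ (j, i)" and z = "\<lambda>k i. \<Sum>l<m. B $$ (i, l) * coeff (p l) k"])
      fix i l assume i: "i < n"
      have "nagata_poly s * (\<Sum>j<m. M i j * x j) =
          (\<Sum>j<m. nagata_const (A $$ (j, i)) * nagata_t ^ d j * (nagata_poly s * x j))"
        using i by (simp add: M_def sum_distrib_left mult_ac)
      also have "\<dots> = nagata_poly (\<Sum>j<m. Polynomial.smult (A $$ (j, i)) (monom 1 (d j) * p j))"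
        unfolding nagata_poly_sum
        by (intro sum.cong refl) (simp add: p nagata_const_poly nagata_t_power mult.assoc flip: nagata_poly_mult)
      finally have "coeff (\<Sum>j<m. Polynomial.smult (A $$ (j, i)) (monom 1 (d j) * p j)) l \<in> I"
        using ext_ideal_iff[OF I(1) s] Mx[of i] i by simp
      also have "coeff (\<Sum>j<m. Polynomial.smult (A $$ (j, i)) (monom 1 (d j) * p j)) l =
          (\<Sum>j<m. A $$ (j, i) * (if d j \<le> l then coeff (p j) (l - d j) else 0))"
        unfolding coeff_sum by (intro sum.cong refl) (auto simp: coeff_monom_mult)
      finally show "(\<Sum>j<m. A $$ (j, i) * (if d j \<le> l then coeff (p j) (l - d j) else 0)) \<in> I" .
    next
      fix r k assume r: "r < m"
      have "nagata_poly s * (\<Sum>j<m. M (n + r) j * x j) =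
          (\<Sum>j<m. ((if j = r then 1 else 0) - nagata_const (?P $$ (r, j))) * (nagata_poly s * x j))"
        by (auto simp: M_def sum_distrib_left mult_ac intro!: sum.cong)
      also have "\<dots> = nagata_poly (\<Sum>j<m. Polynomial.smult ((if j = r then 1 else 0) - ?P $$ (r, j)) (p j))"
        unfolding nagata_poly_sum
      proof (intro sum.cong refl)
        fix j assume "j \<in> {..<m}"
        moreover have "(if j = r then 1 else 0) - nagata_const (?P $$ (r, j)) =
            nagata_const ((if j = r then 1 else 0) - ?P $$ (r, j))" by (simp add: nc.hom_minus)
        moreover have "nagata_const c * nagata_poly q = nagata_poly (Polynomial.smult c q)" for c and q :: "'a poly"
          by (simp add: nagata_const_poly flip: nagata_poly_mult)
        ultimately show "((if j = r then 1 else 0) - nagata_const (?P $$ (r, j))) * (nagata_poly s * x j) =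
            nagata_poly (Polynomial.smult ((if j = r then 1 else 0) - ?P $$ (r, j)) (p j))"
          by (simp only: p lessThan_iff)
      qed
      finally have "coeff (\<Sum>j<m. Polynomial.smult ((if j = r then 1 else 0) - ?P $$ (r, j)) (p j)) k \<in> I"
        using ext_ideal_iff[OF I(1) s] Mx[of "n + r"] r by simp
      also have "coeff (\<Sum>j<m. Polynomial.smult ((if j = r then 1 else 0) - ?P $$ (r, j)) (p j)) k =
          (\<Sum>j<m. (if j = r then coeff (p r) k else 0) - ?P $$ (r, j) * coeff (p j) k)"
        unfolding coeff_sum by (intro sum.cong refl) (simp add: left_diff_distrib)
      also have "\<dots> = coeff (p r) k - (\<Sum>j<m. ?P $$ (r, j) * coeff (p j) k)"
        using r by (simp add: sum_subtractf)
      also have "(\<Sum>j<m. ?P $$ (r, j) * coeff (p j) k) =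
          (\<Sum>j<m. \<Sum>i<n. A $$ (r, i) * (B $$ (i, j) * coeff (p j) k))"
        using A B r by (intro sum.cong refl)
          (simp add: scalar_prod_def sum_distrib_right mult.assoc lessThan_atLeast0)
      also have "\<dots> = (\<Sum>i<n. A $$ (r, i) * (\<Sum>l<m. B $$ (i, l) * coeff (p l) k))"
        by (subst sum.swap) (simp add: sum_distrib_left)
      finally show "coeff (p r) k - (\<Sum>i<n. A $$ (r, i) * (\<Sum>l<m. B $$ (i, l) * coeff (p l) k)) \<in> I" .
    qed (use j in auto)
    thus "x j \<in> ext_ideal I" using ext_ideal_iff[OF I(1) s p[OF j]] by blast
  qed
  then obtain L where L: "\<And>k j. k < m \<Longrightarrow> j < m \<Longrightarrow> (\<Sum>i<n + m. L k i * M i j) = (if k = j then 1 else 0)"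
    by blast
  define L1 where "L1 = mat m n (\<lambda>(k, i). L k i)"
  define L2 where "L2 = mat m m (\<lambda>(k, i). L k (n + i))"
  let ?B = "map_mat nagata_const B"
  have C: "C \<in> carrier_mat m n" and B': "?B \<in> carrier_mat n m" and T: "transpose_mat C \<in> carrier_mat n m"
    and D: "?D \<in> carrier_mat m m" and L1: "L1 \<in> carrier_mat m n" and L2: "L2 \<in> carrier_mat m m"
    using A B by (auto simp: C_def L1_def L2_def)
  have CBC: "C * ?B * C = C"
    using nc.mat_hom_mult[OF A B] nc.mat_hom_mult[OF P A] ABA unfolding C_def by simp
  have CB: "C * ?B \<in> carrier_mat m m" and E: "1\<^sub>m m - C * ?B \<in> carrier_mat m m" using C B' by auto
  have TD: "transpose_mat C * ?D \<in> carrier_mat n m" using T D by simp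
  have one: "L1 * (transpose_mat C * ?D) + L2 * (1\<^sub>m m - C * ?B) = 1\<^sub>m m" (is "?L = _")
  proof (rule eq_matI)
    fix k j assume "k < dim_row (1\<^sub>m m)" "j < dim_col (1\<^sub>m m)"
    hence kj: "k < m" "j < m" by auto
    have 1: "(transpose_mat C * ?D) $$ (i, j) = M i j" if "i < n" for i
      using that kj A C unfolding mat_diag_mult_right[OF T] by (simp add: M_def C_def)
    have 2: "(1\<^sub>m m - C * ?B) $$ (i, j) = M (n + i) j" if "i < m" for i
      unfolding C_def nc.mat_hom_mult[OF A B, symmetric] using that kj P A B by (simp add: M_def)
    have "?L $$ (k, j) = (\<Sum>i<n. L k i * M i j) + (\<Sum>i<m. L k (n + i) * M (n + i) j)"
    proof -
      have "(L1 * (transpose_mat C * ?D)) $$ (k, j) = (\<Sum>i<n. L1 $$ (k, i) * (transpose_mat C * ?D) $$ (i, j))"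
        by (rule mat_mult_index_sum[OF L1 TD kj])
      moreover have "(L2 * (1\<^sub>m m - C * ?B)) $$ (k, j) = (\<Sum>i<m. L2 $$ (k, i) * (1\<^sub>m m - C * ?B) $$ (i, j))"
        by (rule mat_mult_index_sum[OF L2 E kj])
      moreover have "?L $$ (k, j) = (L1 * (transpose_mat C * ?D)) $$ (k, j) + (L2 * (1\<^sub>m m - C * ?B)) $$ (k, j)"
        using mult_carrier_mat[OF L2 E] kj by (intro index_add_mat(1)) auto
      ultimately show ?thesis using kj 1 2
        by (simp add: L1_def L2_def del: index_mult_mat index_minus_mat index_add_mat)
    qed
    also have "\<dots> = (\<Sum>i<n + m. L k i * M i j)"
      by (induction m) (simp_all add: add.assoc)
    finally show "?L $$ (k, j) = 1\<^sub>m m $$ (k, j)" using L[OF kj] kj by simp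
  qed (use L1 L2 TD E in auto)
  have "(1\<^sub>m m - C * ?B) * C = 0\<^sub>m m n"
    using minus_mult_distrib_mat[OF one_carrier_mat CB C] C CBC by simp
  hence "L2 * (1\<^sub>m m - C * ?B) * C = 0\<^sub>m m n" using assoc_mult_mat[OF L2 E C] L2 by simp
  hence "?L * C = L1 * (transpose_mat C * ?D) * C"
    using add_mult_distrib_mat[of "L1 * (transpose_mat C * ?D)" m m "L2 * (1\<^sub>m m - C * ?B)" C n]
      mult_carrier_mat[OF L1 TD] mult_carrier_mat[OF L2 E] C mult_carrier_mat[OF mult_carrier_mat[OF L1 TD] C]
    by (simp del: assoc_mult_mat)
  hence "L1 * (transpose_mat C * ?D * C) = C"
    unfolding one using C assoc_mult_mat[OF L1 TD C] by simp
  thus ?thesis using L1 by blast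
qed

section \<open>Crossed maps\<close>

text \<open>
  \<open>X1\<close> and \<open>X2\<close> give the trivial intersections, \<open>Y1\<close> and \<open>Y2\<close> the sums: for instance, \<open>B v = B (A (Y1 v))\<close> shows that \<open>v\<close>
  differs from the image vector \<open>A (Y1 v)\<close> by an element of the kernel of \<open>B\<close>.
\<close>

lemma crossedI:
  fixes A B :: "'a::comm_ring_1 mat"
  assumes A: "A \<in> carrier_mat m n" and B: "B \<in> carrier_mat n m"
    and X1: "X1 \<in> carrier_mat m n" "X1 * (B * A) = A" and Y1: "Y1 \<in> carrier_mat n m" "B * A * Y1 = B"
    and X2: "X2 \<in> carrier_mat n m" "X2 * (A * B) = B" and Y2: "Y2 \<in> carrier_mat m n" "A * B * Y2 = A"
  shows "crossed A B"
proof -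
  have BA: "B * A \<in> carrier_mat n n" and AB: "A * B \<in> carrier_mat m m" using A B by auto
  have "direct_sum_decomp m (mat_image A) (mat_kernel B)"
  proof (rule direct_sum_decompI[OF submodule_mat_image[OF A] submodule_mat_kernel[OF B]])
    fix v :: "'a vec" assume v: "v \<in> carrier_vec m"
    have w: "Y1 *\<^sub>v v \<in> carrier_vec n" using Y1(1) v by simp
    have "B *\<^sub>v (A *\<^sub>v (Y1 *\<^sub>v v)) = B *\<^sub>v v"
      using assoc_mult_mat_vec[OF BA Y1(1) v] assoc_mult_mat_vec[OF B A w] Y1(2) by simp
    hence "B *\<^sub>v (v - A *\<^sub>v (Y1 *\<^sub>v v)) = 0\<^sub>v n"
      using A B v w by (simp add: mult_minus_distrib_mat_vec[OF B])
    hence "v - A *\<^sub>v (Y1 *\<^sub>v v) \<in> mat_kernel B" using A B v w by (intro mat_kernelI[OF B]) auto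
    thus "\<exists>x\<in>mat_image A. v - x \<in> mat_kernel B" using A w unfolding mat_image_def by auto
  next
    fix x assume "x \<in> mat_image A" and x: "x \<in> mat_kernel B"
    then obtain u where u: "x = A *\<^sub>v u" "u \<in> carrier_vec n" using A unfolding mat_image_def by auto
    have "B * A *\<^sub>v u = 0\<^sub>v n" using mat_kernelD[OF B x] u assoc_mult_mat_vec[OF B A] by simp
    hence "X1 * (B * A) *\<^sub>v u = X1 *\<^sub>v 0\<^sub>v n" using assoc_mult_mat_vec[OF X1(1) BA u(2)] by simp
    also have "\<dots> = 0\<^sub>v m" using X1(1) by (intro eq_vecI) auto
    finally show "x = 0\<^sub>v m" unfolding X1(2) u(1) .
  qed
  moreover have "direct_sum_decomp n (mat_kernel A) (mat_image B)"
  proof (rule direct_sum_decompI[OF submodule_mat_kernel[OF A] submodule_mat_image[OF B]])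
    fix v :: "'a vec" assume v: "v \<in> carrier_vec n"
    have w: "Y2 *\<^sub>v v \<in> carrier_vec m" using Y2(1) v by simp
    have "A *\<^sub>v (B *\<^sub>v (Y2 *\<^sub>v v)) = A *\<^sub>v v"
      using assoc_mult_mat_vec[OF AB Y2(1) v] assoc_mult_mat_vec[OF A B w] Y2(2) by simp
    hence "A *\<^sub>v (v - B *\<^sub>v (Y2 *\<^sub>v v)) = 0\<^sub>v m"
      using A B v w by (simp add: mult_minus_distrib_mat_vec[OF A])
    hence "v - B *\<^sub>v (Y2 *\<^sub>v v) \<in> mat_kernel A" using A B v w by (intro mat_kernelI[OF A]) auto
    moreover have "v - (v - B *\<^sub>v (Y2 *\<^sub>v v)) = B *\<^sub>v (Y2 *\<^sub>v v)" using B v w by (intro eq_vecI) auto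
    hence "v - (v - B *\<^sub>v (Y2 *\<^sub>v v)) \<in> mat_image B" using B w unfolding mat_image_def by auto
    ultimately show "\<exists>x\<in>mat_kernel A. v - x \<in> mat_image B" by blast
  next
    fix x assume x: "x \<in> mat_kernel A" and "x \<in> mat_image B"
    then obtain u where u: "x = B *\<^sub>v u" "u \<in> carrier_vec m" using B unfolding mat_image_def by auto
    have "A * B *\<^sub>v u = 0\<^sub>v m" using mat_kernelD[OF A x] u assoc_mult_mat_vec[OF A B] by simp
    hence "X2 * (A * B) *\<^sub>v u = X2 *\<^sub>v 0\<^sub>v m" using assoc_mult_mat_vec[OF X2(1) AB u(2)] by simp
    also have "\<dots> = 0\<^sub>v n" using X2(1) by (intro eq_vecI) auto
    finally show "x = 0\<^sub>v n" unfolding X2(2) u(1) .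
  qed
  ultimately show ?thesis using A unfolding crossed_def by auto
qed

text \<open>
  Transpose, using that the Gram matrix \<open>C\<^sup>T * D * C\<close> is symmetric.
\<close>

lemma gram_right_cancel:
  fixes C D L :: "'a::comm_ring_1 mat"
  assumes C: "C \<in> carrier_mat m n" and D: "D \<in> carrier_mat m m" "transpose_mat D = D"
    and L: "L \<in> carrier_mat m n" "L * (transpose_mat C * D * C) = C"
  shows "transpose_mat C * D * C * transpose_mat L = transpose_mat C"
proof -
  have T: "transpose_mat C \<in> carrier_mat n m" using C by simp
  have TD: "transpose_mat C * D \<in> carrier_mat n m" using T D by simp
  have TDC: "transpose_mat C * D * C \<in> carrier_mat n n" using TD C by (rule mult_carrier_mat)
  have "transpose_mat (transpose_mat C * D * C) = transpose_mat C * (D * C)"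
    unfolding transpose_mult[OF TD C] transpose_mult[OF T D(1)] using D(2) by simp
  also have "\<dots> = transpose_mat C * D * C" using assoc_mult_mat[OF T D(1) C] by simp
  finally show ?thesis using transpose_mult[OF L(1) TDC] L(2) by simp
qed

lemma transpose_mat_diag: "transpose_mat (mat_diag n f) = mat_diag n f"
  by (intro eq_matI) (auto simp: mat_diag_def)

text \<open>
  Up to the invertible factors \<open>Q\<close>, the products \<open>A\<^sup>\<circ> * A\<close> and \<open>A * A\<^sup>\<circ>\<close> are the Gram matrices \<open>C\<^sup>T * Q\<^sub>m * C\<close> and
  \<open>C * Q\<^sub>n\<^sup>-\<^sup>1 * C\<^sup>T\<close>. The second one has negative exponents; multiplication by the unit \<open>t^(n - 1)\<close> turns \<open>Q\<^sub>n\<^sup>-\<^sup>1\<close> into the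
  diagonal of the distinct natural powers \<open>t^(n - 1 - i)\<close>.
\<close>

lemma locally_simple_imp_crossed:
  fixes A :: "'a::comm_ring_1 mat"
  assumes A: "A \<in> carrier_mat m n" and "locally_simple A"
  shows "crossed (map_mat nagata_const A) (mat_circ A)"
proof -
  obtain B where B: "B \<in> carrier_mat n m" "A * B * A = A"
    using assms(2) unfolding locally_simple_iff[OF A] by blast
  let ?C = "map_mat nagata_const A"
  let ?T = "transpose_mat ?C"
  have C: "?C \<in> carrier_mat m n" and T: "?T \<in> carrier_mat n m" using A by auto
  have At: "transpose_mat A \<in> carrier_mat n m" and Bt: "transpose_mat B \<in> carrier_mat m n"
    using A B by auto
  have ABAt: "transpose_mat A * transpose_mat B * transpose_mat A = transpose_mat A"
    using transpose_mult[OF mult_carrier_mat[OF A B(1)] A] transpose_mult[OF A B(1)] B(2)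
      assoc_mult_mat[OF At Bt At] by simp
  let ?Qm = "Q_mat m :: 'a nagata mat" and ?Qm' = "Q_mat_inv m :: 'a nagata mat"
    and ?Qn = "Q_mat n :: 'a nagata mat" and ?Qn' = "Q_mat_inv n :: 'a nagata mat"
  have Q: "?Qm \<in> carrier_mat m m" "?Qm' \<in> carrier_mat m m" "?Qn \<in> carrier_mat n n" "?Qn' \<in> carrier_mat n n"
    by (simp_all add: Q_mat_def Q_mat_inv_def)
  have inv: "?Qn * ?Qn' = 1\<^sub>m n" "?Qm * ?Qm' = 1\<^sub>m m"
    using Q_mat_inv(1)[of n, where 'a = 'a] Q_mat_inv(1)[of m, where 'a = 'a] Q unfolding inverts_mat_def by auto
  have circ: "mat_circ A = ?Qn' * ?T * ?Qm" using A unfolding mat_circ_def by simp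
  obtain L where L: "L \<in> carrier_mat m n" "L * (?T * ?Qm * ?C) = ?C"
    using gram_left_cancel[OF A B, of "\<lambda>i. i"] unfolding Q_mat_def by auto
  have L': "?T * ?Qm * ?C * transpose_mat L = ?T"
    by (rule gram_right_cancel[OF C Q(1) _ L]) (simp add: Q_mat_def transpose_mat_diag)
  let ?D = "mat_diag n (\<lambda>i. nagata_t ^ (n - 1 - i)) :: 'a nagata mat"
  have "inj_on (\<lambda>i. n - 1 - i) {..<n}" by (auto simp: inj_on_def)
  moreover have "transpose_mat (map_mat nagata_const (transpose_mat A)) = ?C"
    "map_mat nagata_const (transpose_mat A) = ?T" by (intro eq_matI; simp)+
  ultimately obtain K0 where K0: "K0 \<in> carrier_mat n m" "K0 * (?C * ?D * ?T) = ?T"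
    using gram_left_cancel[OF At Bt ABAt, of "\<lambda>i. n - 1 - i"] by metis
  have D: "?D = nagata_t ^ (n - 1) \<cdot>\<^sub>m ?Qn'"
  proof (rule eq_matI)
    fix i j assume "i < dim_row (nagata_t ^ (n - 1) \<cdot>\<^sub>m ?Qn')" "j < dim_col (nagata_t ^ (n - 1) \<cdot>\<^sub>m ?Qn')"
    hence ij: "i < n" "j < n" using Q by auto
    hence t: "(nagata_t ^ (n - 1) :: 'a nagata) = nagata_t ^ (n - 1 - j) * nagata_t ^ j"
      by (simp flip: power_add)
    have "(nagata_t ^ (n - 1) :: 'a nagata) * nagata_t_inv ^ j =
        nagata_t ^ (n - 1 - j) * (nagata_t * nagata_t_inv) ^ j"
      unfolding t by (simp only: power_mult_distrib mult.assoc)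
    thus "?D $$ (i, j) = (nagata_t ^ (n - 1) \<cdot>\<^sub>m ?Qn') $$ (i, j)"
      using ij by (simp add: Q_mat_inv_def mat_diag_def nagata_t_inv)
  qed (use Q in \<open>auto simp: mat_diag_def\<close>)
  define K where "K = nagata_t ^ (n - 1) \<cdot>\<^sub>m K0"
  have K: "K \<in> carrier_mat n m" using K0(1) by (simp add: K_def)
  have CQ: "?C * ?Qn' \<in> carrier_mat m n" using C Q by simp
  have CQT: "?C * ?Qn' * ?T \<in> carrier_mat m m" using CQ T by (rule mult_carrier_mat)
  have KC: "K * (?C * ?Qn' * ?T) = ?T"
  proof -
    have "?C * ?D * ?T = nagata_t ^ (n - 1) \<cdot>\<^sub>m (?C * ?Qn' * ?T)"
      unfolding D by (simp only: mult_smult_distrib[OF C Q(4)] mult_smult_assoc_mat[OF CQ T])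
    hence "K0 * (?C * ?D * ?T) = nagata_t ^ (n - 1) \<cdot>\<^sub>m (K0 * (?C * ?Qn' * ?T))"
      by (simp only: mult_smult_distrib[OF K0(1) CQT])
    thus ?thesis unfolding K_def K0(2) by (simp only: mult_smult_assoc_mat[OF K0(1) CQT])
  qed
  have K': "?C * ?Qn' * ?T * transpose_mat K = ?C"
    using gram_right_cancel[OF T Q(4) _ K] KC by (simp add: Q_mat_inv_def transpose_mat_diag)
  have Lt: "transpose_mat L \<in> carrier_mat n m" and Kt: "transpose_mat K \<in> carrier_mat m n"
    using L(1) K by auto
  note dims = C[THEN carrier_matD(1)] C[THEN carrier_matD(2)] Q[THEN carrier_matD(1)] Q[THEN carrier_matD(2)]
    L(1)[THEN carrier_matD(1)] L(1)[THEN carrier_matD(2)] K[THEN carrier_matD(1)] K[THEN carrier_matD(2)]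
    index_transpose_mat(2,3) index_mult_mat(2,3)
  show ?thesis unfolding circ
  proof (rule crossedI[of _ m n _ "L * ?Qn" "transpose_mat L * ?Qm" "?Qn' * K" "?Qm' * transpose_mat K"])
    have "L * ?Qn * (?Qn' * ?T * ?Qm * ?C) = L * (?Qn * (?Qn' * (?T * ?Qm * ?C)))"
      by (simp only: mult_mat_assoc dims)
    also have "\<dots> = L * (?T * ?Qm * ?C)"
      by (subst inverse_mult_cancel[OF inv(1)]) (simp_all only: dims)
    finally show "L * ?Qn * (?Qn' * ?T * ?Qm * ?C) = ?C" using L(2) by (simp only:)
    have "?Qn' * ?T * ?Qm * ?C * (transpose_mat L * ?Qm) = ?Qn' * (?T * ?Qm * ?C * transpose_mat L) * ?Qm"
      by (simp only: mult_mat_assoc dims)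
    thus "?Qn' * ?T * ?Qm * ?C * (transpose_mat L * ?Qm) = ?Qn' * ?T * ?Qm" unfolding L' .
    have "?Qn' * K * (?C * (?Qn' * ?T * ?Qm)) = ?Qn' * (K * (?C * ?Qn' * ?T)) * ?Qm"
      by (simp only: mult_mat_assoc dims)
    thus "?Qn' * K * (?C * (?Qn' * ?T * ?Qm)) = ?Qn' * ?T * ?Qm" unfolding KC .
    have "?C * (?Qn' * ?T * ?Qm) * (?Qm' * transpose_mat K) = ?C * ?Qn' * ?T * (?Qm * (?Qm' * transpose_mat K))"
      by (simp only: mult_mat_assoc dims)
    also have "\<dots> = ?C * ?Qn' * ?T * transpose_mat K"
      by (subst inverse_mult_cancel[OF inv(2)]) (simp_all only: dims)
    finally show "?C * (?Qn' * ?T * ?Qm) * (?Qm' * transpose_mat K) = ?C" using K' by (simp only:)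
  qed (use C T Q Lt Kt L(1) K in \<open>auto intro!: mult_carrier_mat\<close>)
qed

theorem mainTheorem5:
  fixes A :: "'a::comm_ring_1 mat" and m n :: nat
  assumes "A \<in> carrier_mat m n"
  shows "(locally_simple A \<longleftrightarrow> locally_simple (map_mat nagata_const A)) \<and>
         (locally_simple A \<longleftrightarrow> quasi_simple (map_mat nagata_const A)) \<and>
         (locally_simple A \<longleftrightarrow> crossed (map_mat nagata_const A) (mat_circ A))"
proof -
  let ?C = "map_mat nagata_const A"
  have C: "?C \<in> carrier_mat m n" using assms by simp
  have 12: "locally_simple ?C \<longleftrightarrow> locally_simple A" by (rule locally_simple_nagata_iff[OF assms])
  have 23: "quasi_simple ?C" if "locally_simple ?C"
    unfolding quasi_simple_iff_equiv_diag[OF C]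
    by (rule regular_equiv_diag[OF C that[unfolded locally_simple_iff[OF C]]])
  have 32: "locally_simple ?C" if "quasi_simple ?C" by (rule quasi_simple_imp_locally_simple[OF C that])
  have 14: "crossed ?C (mat_circ A)" if "locally_simple A" by (rule locally_simple_imp_crossed[OF assms that])
  have 42: "locally_simple ?C" if "crossed ?C (mat_circ A)"
    using that unfolding crossed_def locally_simple_def by blast
  show ?thesis using 12 23 32 14 42 by blast
qed

end
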